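(* For every Cayley p.f. linear-time computable representation $\psi : L\rightarrow G$ of a finitely generated group $G$, the language $L$ is recursively enumerable.
   Context: Position-faithful one-tape Turing machine: a Turing machine with one semi-infinite tape (infinite in one direction only) whose left-most cell contains a special symbol $\boxplus$ which occurs only there and cannot be modified. On input $x\in\Sigma^*$ the initial tape content is $\boxplus x\boxdot^\infty$, where $\boxdot$ is a special blank symbol and $\Sigma\cap\{\boxplus,\boxdot\}=\varnothing$, and the head starts at $\boxplus$. The machine computes $f:\Sigma^*\to\Sigma^*$ if on every input $x\in\Sigma^*$ it eventually reaches an accepting state and halts with the tape having prefix $\boxplus f(x)\boxdot$ (no restriction on the tape content after this first $\boxdot$). A function $f:\Sigma^*\to\Sigma^*$ is position-faithful (p.f.) linear-time computable if it is computed by a deterministic position-faithful one-tape Turing machine in time linear in the input length. Let $G$ be a finitely generated group and $S=\{s_1,\dots,s_n\}\subset G$ a finite set of semigroup generators (every $g\in G$ is a product of elements of $S$). A Cayley p.f. linear-time computable representation of $G$ is a bijection $\psi:L\to G$, where $L\subseteq\Sigma^*$ is a language over a finite alphabet $\Sigma$, for which there exist p.f. linear-time computable functions $f_i:\Sigma^*\to\Sigma^*$, $i=1,\dots,n$, with $f_i(L)\subseteq L$ and $\psi(f_i(w))=\psi(w)s_i$ for all $w\in L$. *)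

theory Defs
  imports "HOL-Algebra.Group"
begin

section \<open>Position-faithful one-tape Turing machines\<close>

text \<open>
  Tape symbols over an input alphabet contained in \<open>'a\<close>. \<open>LeftEnd\<close> is the box-plus symbol,
  \<open>Blank\<close> the box-dot symbol, and \<open>Aux k\<close> are auxiliary work symbols. States and work symbols are
  natural numbers; as machines are finite, this is no restriction.
\<close>

datatype 'a symb = LeftEnd | Blank | Letter 'a | Aux nat

datatype move = MoveLeft | Stay | MoveRight

record 'a tm =
  tm_states :: "nat set"
  tm_symbols :: "'a symb set"
  tm_start :: nat
  tm_accepting :: "nat set"
  tm_delta :: "nat \<Rightarrow> 'a symb \<Rightarrow> (nat \<times> 'a symb \<times> move) option"

text \<open>
  The transition function is partial; the machine halts where it is undefined. The last condition
  says that the left end marker is never overwritten and never written elsewhere.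
\<close>

definition pf_tm :: "'a set \<Rightarrow> 'a tm \<Rightarrow> bool" where
  "pf_tm \<Sigma> M \<longleftrightarrow>
     finite (tm_states M) \<and> finite (tm_symbols M) \<and>
     {LeftEnd, Blank} \<union> Letter ` \<Sigma> \<subseteq> tm_symbols M \<and>
     tm_start M \<in> tm_states M \<and> tm_accepting M \<subseteq> tm_states M \<and>
     (\<forall>q a q' b d. tm_delta M q a = Some (q', b, d) \<longrightarrow>
        q \<in> tm_states M \<and> a \<in> tm_symbols M \<and>
        q' \<in> tm_states M \<and> b \<in> tm_symbols M \<and>
        (b = LeftEnd \<longleftrightarrow> a = LeftEnd))"

record 'a config =
  state :: nat
  tape :: "nat \<Rightarrow> 'a symb"
  head :: nat

definition initial_config :: "'a tm \<Rightarrow> 'a list \<Rightarrow> 'a config" where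
  "initial_config M x =
     \<lparr>state = tm_start M,
      tape = (\<lambda>i. if i = 0 then LeftEnd
                  else if i \<le> length x then Letter (x ! (i - 1)) else Blank),
      head = 0\<rparr>"

text \<open>Moving left from cell 0 leaves the head in place.\<close>

fun move_head :: "move \<Rightarrow> nat \<Rightarrow> nat" where
  "move_head MoveLeft h = h - 1"
| "move_head Stay h = h"
| "move_head MoveRight h = Suc h"

text \<open>A halted configuration is its own successor.\<close>

definition step :: "'a tm \<Rightarrow> 'a config \<Rightarrow> 'a config" where
  "step M c =
     (case tm_delta M (state c) (tape c (head c)) of
        None \<Rightarrow> c
      | Some (q, b, d) \<Rightarrow>
          \<lparr>state = q, tape = (tape c)(head c := b), head = move_head d (head c)\<rparr>)"

definition run :: "'a tm \<Rightarrow> 'a list \<Rightarrow> nat \<Rightarrow> 'a config" where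
  "run M x t = (step M ^^ t) (initial_config M x)"

definition halts_accepting :: "'a tm \<Rightarrow> 'a config \<Rightarrow> bool" where
  "halts_accepting M c \<longleftrightarrow>
     tm_delta M (state c) (tape c (head c)) = None \<and> state c \<in> tm_accepting M"

definition has_output :: "'a config \<Rightarrow> 'a list \<Rightarrow> bool" where
  "has_output c y \<longleftrightarrow>
     tape c 0 = LeftEnd \<and> (\<forall>i<length y. tape c (Suc i) = Letter (y ! i)) \<and>
     tape c (Suc (length y)) = Blank"

text \<open>
  The time bound is \<open>C * (n + 1)\<close> rather than \<open>C * n\<close>, so that the empty input is allowed
  a constant number of steps.
\<close>

definition pf_linear_time_computable :: "'a set \<Rightarrow> ('a list \<Rightarrow> 'a list) \<Rightarrow> bool" where
  "pf_linear_time_computable \<Sigma> f \<longleftrightarrow>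
     f ` lists \<Sigma> \<subseteq> lists \<Sigma> \<and>
     (\<exists>M C. pf_tm \<Sigma> M \<and>
        (\<forall>x\<in>lists \<Sigma>. \<exists>t \<le> C * (length x + 1).
           halts_accepting M (run M x t) \<and> has_output (run M x t) (f x)))"

text \<open>
  Recursive enumerability is recognizability by a deterministic Turing machine, with no time bound
  and no promise of halting outside the language.
\<close>

definition recursively_enumerable :: "'a set \<Rightarrow> 'a list set \<Rightarrow> bool" where
  "recursively_enumerable \<Sigma> L \<longleftrightarrow>
     L \<subseteq> lists \<Sigma> \<and>
     (\<exists>M. pf_tm \<Sigma> M \<and>
        (\<forall>x\<in>lists \<Sigma>. x \<in> L \<longleftrightarrow> (\<exists>t. halts_accepting M (run M x t))))"


section \<open>Cayley representations\<close>

definition semigroup_generators :: "('g, 'm) monoid_scheme \<Rightarrow> 'g set \<Rightarrow> bool" where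
  "semigroup_generators G S \<longleftrightarrow>
     S \<subseteq> carrier G \<and>
     (\<forall>g\<in>carrier G. \<exists>ss. ss \<noteq> [] \<and> set ss \<subseteq> S \<and> g = foldr (\<otimes>\<^bsub>G\<^esub>) ss \<one>\<^bsub>G\<^esub>)"

definition cayley_pf_linear_time_representation ::
  "('g, 'm) monoid_scheme \<Rightarrow> 'g set \<Rightarrow> 'a set \<Rightarrow> 'a list set \<Rightarrow> ('a list \<Rightarrow> 'g) \<Rightarrow> bool" where
  "cayley_pf_linear_time_representation G S \<Sigma> L \<psi> \<longleftrightarrow>
     finite \<Sigma> \<and> L \<subseteq> lists \<Sigma> \<and> bij_betw \<psi> L (carrier G) \<and>
     (\<exists>f. \<forall>s\<in>S. pf_linear_time_computable \<Sigma> (f s) \<and> f s ` L \<subseteq> L \<and>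
        (\<forall>w\<in>L. \<psi> (f s w) = \<psi> w \<otimes>\<^bsub>G\<^esub> s))"

end

theory Submission
  imports Defs
begin

text \<open>
  Let \<open>w0\<close> be the word that represents the identity. Every group element is a product of
  generators, and \<open>\<psi>\<close> is injective, so \<open>L\<close> is exactly the orbit of \<open>w0\<close> under the functions
  \<open>f s\<close>, \<open>s \<in> S\<close>. A machine can therefore recognize \<open>L\<close> by running through all words over \<open>S\<close>,
  applying the corresponding functions to \<open>w0\<close> one after the other, and accepting as soon as the
  result equals the input. Each application terminates, because the \<open>f s\<close> are total on
  \<open>lists \<Sigma>\<close>; so no dovetailing is necessary, and a word outside the orbit makes the search run
  forever.

  Almost all of the text is the construction of this machine as a single-tape Turing machine. It is
  a compilation in three stages; wherever one system implements another, halting is transferred by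
  the same simulation principle (\<open>halts_simulation\<close>).

  \<^item> The search is a while program over six stacks. Two of them hold the two halves of the tape of
    a simulated machine, so rewinding that tape, cutting its output off at the first blank and
    erasing the remainder are loops that pour one stack into another (\<open>exec_apply_generator\<close>,
    \<open>search_halts\<close>).
  \<^item> A while program is a stack machine whose states are the residual programs
    (\<open>program_recognizable\<close>).
  \<^item> A stack machine runs on one tape with one track per stack, all tops being in the cell next to
    the end marker (\<open>stack_machine_recognizable\<close>). A push or pop is one sweep that shifts a track
    by one cell. With this layout the ordinary input tape is already the encoding of the input on
    one stack, with all other stacks empty.
\<close>

section \<open>Iterating a step function\<close>

definition reaches :: "('c \<Rightarrow> 'c) \<Rightarrow> 'c \<Rightarrow> 'c \<Rightarrow> bool" where
  "reaches f c d \<longleftrightarrow> (\<exists>n. (f ^^ n) c = d)"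

definition halts :: "('c \<Rightarrow> 'c) \<Rightarrow> ('c \<Rightarrow> bool) \<Rightarrow> 'c \<Rightarrow> bool" where
  "halts f H c \<longleftrightarrow> (\<exists>n. H ((f ^^ n) c))"

lemma reaches_refl [simp]: "reaches f c c"
  unfolding reaches_def by (rule exI[of _ 0]) simp

lemma reaches_step: "reaches f (f c) d \<Longrightarrow> reaches f c d"
  unfolding reaches_def by (metis funpow_Suc_right comp_apply)

lemma reaches_trans [trans]: "reaches f c d \<Longrightarrow> reaches f d e \<Longrightarrow> reaches f c e"
  unfolding reaches_def by (metis funpow_add comp_apply)

lemma halts_step: "halts f H (f c) \<Longrightarrow> halts f H c"
  unfolding halts_def by (metis funpow_Suc_right comp_apply)

lemma halts_step_iff:
  assumes "\<not> H c"
  shows "halts f H (f c) \<longleftrightarrow> halts f H c"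
proof
  assume "halts f H c"
  then obtain n where n: "H ((f ^^ n) c)" by (auto simp: halts_def)
  then obtain m where "n = Suc m" using assms by (cases n) auto
  then have "H ((f ^^ m) (f c))" using n by (simp only: funpow_Suc_right comp_apply)
  then show "halts f H (f c)" by (auto simp: halts_def)
qed (rule halts_step)

lemma funpow_halted:
  assumes "\<And>c. H c \<Longrightarrow> f c = c" "H c"
  shows "(f ^^ n) c = c"
  using assms by (induction n) auto

text \<open>
  A set of non-halted configurations that the computation always returns to excludes halting: a
  halted configuration would stay as it is, but later the set is visited again.
\<close>

lemma never_halts:
  assumes stable: "\<And>c. H c \<Longrightarrow> f c = c"
    and "\<And>c. P c \<Longrightarrow> \<not> H c"
    and recur: "\<And>c. P c \<Longrightarrow> \<exists>d. reaches f (f c) d \<and> P d"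
    and "P c"
  shows "\<not> halts f H c"
proof
  assume "halts f H c"
  then obtain t where t: "H ((f ^^ t) c)" by (auto simp: halts_def)
  have "\<exists>k\<ge>m. P ((f ^^ k) c)" for m
  proof (induction m)
    case 0
    show ?case using \<open>P c\<close> by (intro exI[of _ 0]) simp
  next
    case (Suc m)
    then obtain k where k: "k \<ge> m" "P ((f ^^ k) c)" by blast
    obtain j where "P ((f ^^ j) (f ((f ^^ k) c)))"
      using recur[OF k(2)] by (auto simp: reaches_def)
    then have "P ((f ^^ (j + Suc k)) c)" by (simp add: funpow_add funpow_swap1)
    then show ?case using k(1) by (intro exI[of _ "j + Suc k"]) auto
  qed
  then obtain k where k: "k \<ge> t" "P ((f ^^ k) c)" by blast
  have "(f ^^ k) c = (f ^^ (k - t)) ((f ^^ t) c)"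
    using k(1) by (metis funpow_add comp_apply le_add_diff_inverse2)
  also have "\<dots> = (f ^^ t) c" using funpow_halted[of H f, OF stable t] .
  finally show False using t k(2) assms(2) by metis
qed

text \<open>
  One step of \<open>f\<close> may take any positive number of steps of \<open>g\<close>. Positivity, expressed by
  \<open>reaches g (g b) b'\<close>, makes \<open>g\<close> diverge whenever \<open>f\<close> does, so that halting transfers in both
  directions. \<open>R\<close> is a relation and not a function because the simulating configuration may
  carry irrelevant remains of the past.
\<close>

lemma halts_simulation:
  assumes stable: "\<And>b. Hb b \<Longrightarrow> g b = b"
    and halted: "\<And>a b. R a b \<Longrightarrow> Ha a \<longleftrightarrow> Hb b"
    and move: "\<And>a b. R a b \<Longrightarrow> \<not> Ha a \<Longrightarrow> \<exists>b'. reaches g (g b) b' \<and> R (f a) b'"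
    and "R a b"
  shows "halts f Ha a \<longleftrightarrow> halts g Hb b"
proof
  assume "halts f Ha a"
  then obtain n where "Ha ((f ^^ n) a)" by (auto simp: halts_def)
  then show "halts g Hb b" using \<open>R a b\<close>
  proof (induction n arbitrary: a b)
    case 0
    then show ?case using halted by (auto simp: halts_def intro: exI[of _ 0])
  next
    case (Suc n)
    show ?case
    proof (cases "Ha a")
      case True
      then show ?thesis using halted[OF Suc.prems(2)] by (auto simp: halts_def intro: exI[of _ 0])
    next
      case False
      obtain b' where b': "reaches g (g b) b'" "R (f a) b'" using move[OF Suc.prems(2) False] by blast
      have "Ha ((f ^^ n) (f a))" using Suc.prems(1) by (simp only: funpow_Suc_right comp_apply)
      then have "halts g Hb b'" using Suc.IH b'(2) by blast
      moreover have "reaches g b b'" using b'(1) by (rule reaches_step)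
      ultimately show ?thesis unfolding halts_def reaches_def by (metis funpow_add comp_apply)
    qed
  qed
next
  have "\<not> halts g Hb b" if "\<not> halts f Ha a"
  proof (rule never_halts[where P = "\<lambda>b. \<exists>a. R a b \<and> \<not> halts f Ha a"])
    show "Hb c \<Longrightarrow> g c = c" for c by (rule stable)
    have H: "\<not> Ha a" if "\<not> halts f Ha a" for a
      using that unfolding halts_def by (metis funpow_0)
    show "\<exists>a. R a c \<and> \<not> halts f Ha a \<Longrightarrow> \<not> Hb c" for c
      using H halted by blast
    show "\<exists>a. R a c \<and> \<not> halts f Ha a \<Longrightarrow> \<exists>d. reaches g (g c) d \<and> (\<exists>a. R a d \<and> \<not> halts f Ha a)" for c
      using H move halts_step by metis
    show "\<exists>a. R a b \<and> \<not> halts f Ha a" using that \<open>R a b\<close> by blast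
  qed
  then show "halts g Hb b \<Longrightarrow> halts f Ha a" by blast
qed


section \<open>Turing machines with arbitrary states and cell contents\<close>

text \<open>
  \<open>None\<close> is the left end marker and \<open>Some c\<close> a cell with content \<open>c\<close>. Keeping the marker apart
  from the contents lets a single condition, \<open>b = None \<longleftrightarrow> a = None\<close>, express that it is neither
  moved nor overwritten.
\<close>

type_synonym ('q, 'c) rules = "'q \<Rightarrow> 'c option \<Rightarrow> ('q \<times> 'c option \<times> move) option"

fun astep :: "('q, 'c) rules \<Rightarrow> 'q \<times> (nat \<Rightarrow> 'c option) \<times> nat \<Rightarrow> 'q \<times> (nat \<Rightarrow> 'c option) \<times> nat" where
  "astep \<delta> (q, T, h) =
     (case \<delta> q (T h) of None \<Rightarrow> (q, T, h) | Some (q', b, m) \<Rightarrow> (q', T(h := b), move_head m h))"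

fun ahalted :: "('q, 'c) rules \<Rightarrow> 'q \<times> (nat \<Rightarrow> 'c option) \<times> nat \<Rightarrow> bool" where
  "ahalted \<delta> (q, T, h) \<longleftrightarrow> \<delta> q (T h) = None"

definition input_tape :: "'c \<Rightarrow> ('a \<Rightarrow> 'c) \<Rightarrow> 'a list \<Rightarrow> nat \<Rightarrow> 'c option" where
  "input_tape blank letter x =
     (\<lambda>i. if i = 0 then None else if i \<le> length x then Some (letter (x ! (i - 1))) else Some blank)"

text \<open>
  Finitely many states and contents can be numbered injectively. Only the end marker, blanks and
  input letters have prescribed names; all other contents become auxiliary symbols. All states may be accepting,
  so accepting is the same as halting.
\<close>

lemma machine_renaming:
  fixes \<Sigma> :: "'a set" and \<delta> :: "('q, 'c) rules" and letter :: "'a \<Rightarrow> 'c"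
  assumes "finite Q" "finite C" "q0 \<in> Q"
    and "blank \<in> C" "letter ` \<Sigma> \<subseteq> C" "inj_on letter \<Sigma>" "blank \<notin> letter ` \<Sigma>"
    and closed: "\<And>q a q' b m. q \<in> Q \<Longrightarrow> a \<in> insert None (Some ` C) \<Longrightarrow> \<delta> q a = Some (q', b, m) \<Longrightarrow>
           q' \<in> Q \<and> b \<in> insert None (Some ` C) \<and> (b = None \<longleftrightarrow> a = None)"
  shows "\<exists>M. pf_tm \<Sigma> M \<and> (\<forall>x\<in>lists \<Sigma>. (\<exists>t. halts_accepting M (run M x t)) \<longleftrightarrow>
           halts (astep \<delta>) (ahalted \<delta>) (q0, input_tape blank letter x, 0))"
proof -
  define A where "A = insert None (Some ` C)"
  obtain e :: "'q \<Rightarrow> nat" where e: "inj_on e Q"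
    using finite_imp_inj_to_nat_seg[OF \<open>finite Q\<close>] by blast
  obtain idx :: "'c \<Rightarrow> nat" where idx: "inj_on idx C"
    using finite_imp_inj_to_nat_seg[OF \<open>finite C\<close>] by blast
  define enc :: "'c option \<Rightarrow> 'a symb" where
    "enc a = (case a of None \<Rightarrow> LeftEnd | Some c \<Rightarrow>
       if c = blank then Blank
       else if c \<in> letter ` \<Sigma> then Letter (inv_into \<Sigma> letter c) else Aux (idx c))" for a
  have enc_simps: "enc None = LeftEnd" "enc (Some blank) = Blank"
    "\<And>a. a \<in> \<Sigma> \<Longrightarrow> enc (Some (letter a)) = Letter a"
    using assms(6,7) by (auto simp: enc_def)
  have enc_LeftEnd: "enc b = LeftEnd \<longleftrightarrow> b = None" for b
    by (auto simp: enc_def split: option.splits)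
  have enc: "inj_on enc A"
    unfolding inj_on_def A_def enc_def using inj_onD[OF idx]
    by (auto split: if_splits simp: inv_into_f_f[OF \<open>inj_on letter \<Sigma>\<close>])
  define M :: "'a tm" where "M = \<lparr>tm_states = e ` Q, tm_symbols = enc ` A, tm_start = e q0,
     tm_accepting = e ` Q,
     tm_delta = (\<lambda>p a. if p \<in> e ` Q \<and> a \<in> enc ` A then
        map_option (\<lambda>(q, b, m). (e q, enc b, m)) (\<delta> (inv_into Q e p) (inv_into A enc a)) else None)\<rparr>"
  have M_simps: "tm_start M = e q0" "tm_accepting M = e ` Q" "tm_states M = e ` Q" "tm_symbols M = enc ` A"
    by (simp_all add: M_def)
  have delta: "tm_delta M (e q) (enc a) = map_option (\<lambda>(q, b, m). (e q, enc b, m)) (\<delta> q a)"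
    if "q \<in> Q" "a \<in> A" for q a
    using that e enc by (simp add: M_def)
  have "pf_tm \<Sigma> M"
    unfolding pf_tm_def
  proof (intro conjI allI impI)
    show "{LeftEnd, Blank} \<union> Letter ` \<Sigma> \<subseteq> tm_symbols M"
    proof -
      have "enc None \<in> enc ` A" "enc (Some blank) \<in> enc ` A"
        using assms(4) by (simp_all add: A_def)
      moreover have "Letter a \<in> enc ` A" if "a \<in> \<Sigma>" for a
      proof -
        have "Some (letter a) \<in> A" using assms(5) that by (auto simp: A_def)
        then show ?thesis using enc_simps(3)[OF that] by (metis imageI)
      qed
      ultimately show ?thesis by (auto simp: M_simps enc_simps(1,2))
    qed
  next
    fix p a p' b d assume *: "tm_delta M p a = Some (p', b, d)"
    then obtain q a0 where q: "q \<in> Q" "p = e q" "a0 \<in> A" "a = enc a0"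
      by (auto simp: M_def split: if_splits)
    then obtain q' b0 where q': "\<delta> q a0 = Some (q', b0, d)" "p' = e q'" "b = enc b0"
      using * delta[of q a0] by auto
    have "q' \<in> Q \<and> b0 \<in> A \<and> (b0 = None \<longleftrightarrow> a0 = None)"
      unfolding A_def by (rule closed[OF q(1) q(3)[unfolded A_def] q'(1)])
    then show "p \<in> tm_states M" "a \<in> tm_symbols M" "p' \<in> tm_states M" "b \<in> tm_symbols M"
      "b = LeftEnd \<longleftrightarrow> a = LeftEnd"
      using q q' by (simp_all add: M_simps enc_LeftEnd)
  qed (use assms(1-3) in \<open>simp_all add: M_simps A_def\<close>)
  moreover have "\<forall>x\<in>lists \<Sigma>. (\<exists>t. halts_accepting M (run M x t)) \<longleftrightarrow>
      halts (astep \<delta>) (ahalted \<delta>) (q0, input_tape blank letter x, 0)"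
  proof
    fix x assume x: "x \<in> lists \<Sigma>"
    define R where "R a c = (case a of (q, T, h) \<Rightarrow>
       q \<in> Q \<and> range T \<subseteq> A \<and> c = \<lparr>state = e q, tape = (\<lambda>i. enc (T i)), head = h\<rparr>)" for a and c :: "'a config"
    have "halts (astep \<delta>) (ahalted \<delta>) (q0, input_tape blank letter x, 0) \<longleftrightarrow>
        halts (step M) (halts_accepting M) (initial_config M x)"
    proof (rule halts_simulation[where R = R])
      show "halts_accepting M b \<Longrightarrow> step M b = b" for b
        by (simp add: halts_accepting_def step_def)
      show "ahalted \<delta> a \<longleftrightarrow> halts_accepting M b" if R: "R a b" for a b
      proof (cases a)
        case (fields q T h)
        then have "q \<in> Q" "T h \<in> A" using R by (auto simp: R_def)
        then have "tm_delta M (e q) (enc (T h)) = None \<longleftrightarrow> \<delta> q (T h) = None" "e q \<in> tm_accepting M"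
          using delta[of q "T h"] by (simp_all add: M_simps)
        then show ?thesis using R fields by (simp add: R_def halts_accepting_def)
      qed
      show "\<exists>b'. reaches (step M) (step M b) b' \<and> R (astep \<delta> a) b'"
        if R: "R a b" and nh: "\<not> ahalted \<delta> a" for a b
      proof (cases a)
        case (fields q T h)
        then have q: "q \<in> Q" "T h \<in> A" using R by (auto simp: R_def)
        obtain q' c m where d: "\<delta> q (T h) = Some (q', c, m)" using nh fields by auto
        have b: "b = \<lparr>state = e q, tape = (\<lambda>i. enc (T i)), head = h\<rparr>" and T: "range T \<subseteq> A"
          using R fields by (auto simp: R_def)
        have "q' \<in> Q \<and> c \<in> A \<and> (c = None \<longleftrightarrow> T h = None)"
          unfolding A_def by (rule closed[OF q(1) q(2)[unfolded A_def] d])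
        then have qc: "q' \<in> Q" "c \<in> A" by simp_all
        have "step M b = \<lparr>state = e q', tape = (\<lambda>i. enc ((T(h := c)) i)), head = move_head m h\<rparr>"
          using d delta[OF q] by (simp add: b step_def fun_eq_iff)
        moreover have "range (T(h := c)) \<subseteq> A" using T qc(2) by auto
        ultimately have "R (astep \<delta> a) (step M b)"
          using fields d qc(1) by (simp add: R_def)
        then show ?thesis by (intro exI[of _ "step M b"]) simp
      qed
      have "tape (initial_config M x) = (\<lambda>i. enc (input_tape blank letter x i))"
        using x by (auto simp: initial_config_def input_tape_def fun_eq_iff enc_simps in_lists_conv_set)
      moreover have "range (input_tape blank letter x) \<subseteq> A"
        using x assms(4,5) unfolding A_def input_tape_def
        by (auto simp: in_lists_conv_set image_subset_iff)
      ultimately show "R (q0, input_tape blank letter x, 0) (initial_config M x)"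
        using \<open>q0 \<in> Q\<close> by (simp add: R_def initial_config_def M_simps)
    qed
    then show "(\<exists>t. halts_accepting M (run M x t)) \<longleftrightarrow>
      halts (astep \<delta>) (ahalted \<delta>) (q0, input_tape blank letter x, 0)"
      by (simp only: halts_def run_def)
  qed
  ultimately show ?thesis by (intro exI[of _ M] conjI)
qed


section \<open>Stack machines\<close>

datatype ('i, 'b) op = Nop | Push 'i 'b | Pop 'i

fun apply_op :: "('i, 'b) op \<Rightarrow> ('i \<Rightarrow> 'b list) \<Rightarrow> 'i \<Rightarrow> 'b list" where
  "apply_op Nop s = s"
| "apply_op (Push i a) s = s(i := a # s i)"
| "apply_op (Pop i) s = s(i := tl (s i))"

definition layer :: "('i \<Rightarrow> 'b list) \<Rightarrow> nat \<Rightarrow> 'i \<Rightarrow> 'b option" where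
  "layer s j = (\<lambda>i. if j < length (s i) then Some (s i ! j) else None)"

abbreviation tops :: "('i \<Rightarrow> 'b list) \<Rightarrow> 'i \<Rightarrow> 'b option" where
  "tops s \<equiv> layer s 0"

lemma tops_simp [simp]: "tops s i = (case s i of [] \<Rightarrow> None | a # _ \<Rightarrow> Some a)"
  by (simp add: layer_def split: list.split)

type_synonym ('q, 'i, 'b) control = "'q \<Rightarrow> ('i \<Rightarrow> 'b option) \<Rightarrow> ('q \<times> ('i, 'b) op) option"

fun sstep :: "('q, 'i, 'b) control \<Rightarrow> 'q \<times> ('i \<Rightarrow> 'b list) \<Rightarrow> 'q \<times> ('i \<Rightarrow> 'b list)" where
  "sstep ctl (q, s) = (case ctl q (tops s) of None \<Rightarrow> (q, s) | Some (q', p) \<Rightarrow> (q', apply_op p s))"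

fun shalted :: "('q, 'i, 'b) control \<Rightarrow> 'q \<times> ('i \<Rightarrow> 'b list) \<Rightarrow> bool" where
  "shalted ctl (q, s) \<longleftrightarrow> ctl q (tops s) = None"

text \<open>
  The phases of executing one stack operation on the tape. In \<open>Insert i a q\<close> and
  \<open>Delete i a q\<close> the head carries the entry \<open>a\<close> that is to be written to track \<open>i\<close> of the
  scanned cell, and \<open>q\<close> is the state to continue with. An insertion sweeps to the right and
  displaces each entry by one cell; a deletion first seeks the end of the track and then sweeps
  back to the left. \<open>Look q\<close> scans the cell that contains all the tops.
\<close>

datatype ('q, 'i, 'b) phase = Look 'q | Insert 'i 'b 'q | Back 'q | Seek 'i 'q | Delete 'i "'b option" 'q

fun sweep :: "('q, 'i, 'b) control \<Rightarrow> (('q, 'i, 'b) phase, 'i \<Rightarrow> 'b option) rules" where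
  "sweep ctl (Look q) None = Some (Look q, None, MoveRight)"
| "sweep ctl (Back q) None = Some (Look q, None, MoveRight)"
| "sweep ctl (Delete i a q) None = Some (Look q, None, MoveRight)"
| "sweep ctl (Look q) (Some t) = (case ctl q t of None \<Rightarrow> None
     | Some (q', Nop) \<Rightarrow> Some (Look q', Some t, Stay)
     | Some (q', Push i a) \<Rightarrow> Some (Insert i a q', Some t, Stay)
     | Some (q', Pop i) \<Rightarrow> Some (Seek i q', Some t, Stay))"
| "sweep ctl (Insert i a q) (Some t) = (case t i of
       None \<Rightarrow> Some (Back q, Some (t(i := Some a)), MoveLeft)
     | Some b \<Rightarrow> Some (Insert i b q, Some (t(i := Some a)), MoveRight))"
| "sweep ctl (Back q) (Some t) = Some (Back q, Some t, MoveLeft)"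
| "sweep ctl (Seek i q) (Some t) =
     Some (if t i = None then (Delete i None q, Some t, MoveLeft) else (Seek i q, Some t, MoveRight))"
| "sweep ctl (Delete i a q) (Some t) = Some (Delete i (t i) q, Some (t(i := a)), MoveLeft)"
| "sweep ctl _ _ = None"

definition stack_tape :: "('i \<Rightarrow> 'b list) \<Rightarrow> nat \<Rightarrow> ('i \<Rightarrow> 'b option) option" where
  "stack_tape s = (\<lambda>k. case k of 0 \<Rightarrow> None | Suc j \<Rightarrow> Some (layer s j))"

lemma stack_tape_simps [simp]: "stack_tape s 0 = None" "stack_tape s (Suc j) = Some (layer s j)"
  by (simp_all add: stack_tape_def)

lemma sweep_back: "reaches (astep (sweep ctl)) (Back q, stack_tape s, h) (Look q, stack_tape s, 1)"
proof (induction h)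
  case 0
  show ?case by (rule reaches_step) (simp add: fun_upd_idem)
next
  case (Suc h)
  then show ?case by (intro reaches_step[of _ "(Back q, stack_tape s, Suc h)"]) (simp add: fun_upd_idem)
qed

text \<open>
  During the sweep the tape agrees with the new stacks left of the head and with the old ones
  elsewhere, and the carried entry is the next one of the new stack.
\<close>

lemma sweep_insert:
  "reaches (astep (sweep ctl)) (Insert i a q, stack_tape s, 1) (Look q, stack_tape (s(i := a # s i)), 1)"
proof -
  define s' where "s' = s(i := a # s i)"
  define T where "T m k = (if k \<le> m then stack_tape s' k else stack_tape s k)" for m k
  have layer_insert: "(layer s m)(i := Some ((a # s i) ! m)) = layer s' m" if "m \<le> length (s i)" for m
    using that by (auto simp: s'_def fun_eq_iff layer_def)
  have T_Suc: "(T m)(Suc m := Some (layer s' m)) = T (Suc m)" for m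
    by (rule ext) (auto simp: T_def le_Suc_eq)
  have T_Suc_m: "T m (Suc m) = Some (layer s m)" for m
    by (simp add: T_def)
  have T_0: "T 0 = stack_tape s"
    by (rule ext) (simp add: T_def)
  have T_final: "T (Suc (length (s i))) = stack_tape s'"
    by (rule ext) (auto simp: T_def s'_def stack_tape_def layer_def fun_eq_iff split: nat.split)
  have "reaches (astep (sweep ctl)) (Insert i ((a # s i) ! m) q, T m, Suc m) (Look q, stack_tape s', 1)"
    if "m \<le> length (s i)" for m
    using that
  proof (induction rule: inc_induct)
    case base
    have "layer s (length (s i)) i = None" by (simp add: layer_def)
    then have eq: "astep (sweep ctl) (Insert i ((a # s i) ! length (s i)) q, T (length (s i)), Suc (length (s i))) =
        (Back q, stack_tape s', length (s i))"
      by (simp add: T_Suc_m T_Suc layer_insert T_final)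
    show ?case by (rule reaches_step) (simp only: eq sweep_back)
  next
    case (step m)
    have "layer s m i = Some ((a # s i) ! Suc m)" using step.hyps by (simp add: layer_def)
    then have eq: "astep (sweep ctl) (Insert i ((a # s i) ! m) q, T m, Suc m) =
        (Insert i ((a # s i) ! Suc m) q, T (Suc m), Suc (Suc m))"
      using step.hyps by (simp del: nth_Cons_Suc add: T_Suc_m T_Suc layer_insert)
    show ?case by (rule reaches_step) (simp only: eq step.IH)
  qed
  from this[of 0] show ?thesis by (simp add: T_0 s'_def)
qed

text \<open>
  The mirror image: on the way back the tape agrees with the new stacks right of the head. The
  entry carried into the end marker is the old top, which is thereby discarded; for an empty stack
  nothing is carried.
\<close>

lemma sweep_delete:
  "reaches (astep (sweep ctl)) (Seek i q, stack_tape s, 1) (Look q, stack_tape (s(i := tl (s i))), 1)"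
proof -
  let ?n = "length (s i)"
  define s' where "s' = s(i := tl (s i))"
  define T where "T m k = (if k \<le> m then stack_tape s k else stack_tape s' k)" for m k
  (* Going left, a cell receives the entry of its right neighbour. *)
  have layer_delete: "(layer s m)(i := layer s (Suc m) i) = layer s' m" for m
    by (auto simp: s'_def fun_eq_iff layer_def nth_tl)
  have T_Suc: "(T (Suc m))(Suc m := Some (layer s' m)) = T m" for m
    by (rule ext) (auto simp: T_def le_Suc_eq)
  have T_m: "T (Suc m) (Suc m) = Some (layer s m)" "T 0 0 = None" for m
    by (simp_all add: T_def)
  have T_0: "T 0 = stack_tape s'"
    by (rule ext) (simp add: T_def)
  have T_start: "T ?n = stack_tape s"
    by (rule ext) (auto simp: T_def s'_def stack_tape_def layer_def fun_eq_iff split: nat.split)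
  have shift: "reaches (astep (sweep ctl)) (Delete i (layer s m i) q, T m, m) (Look q, stack_tape s', 1)" for m
  proof (induction m)
    case 0
    show ?case by (rule reaches_step) (simp add: fun_upd_idem T_0)
  next
    case (Suc m)
    have eq: "astep (sweep ctl) (Delete i (layer s (Suc m) i) q, T (Suc m), Suc m) =
        (Delete i (layer s m i) q, T m, m)"
      by (simp add: T_m layer_delete T_Suc)
    show ?case by (rule reaches_step) (simp only: eq Suc.IH)
  qed
  have "reaches (astep (sweep ctl)) (Seek i q, stack_tape s, Suc m) (Look q, stack_tape s', 1)"
    if "m \<le> ?n" for m
    using that
  proof (induction rule: inc_induct)
    case base
    have "layer s ?n i = None" by (simp add: layer_def)
    then have eq: "astep (sweep ctl) (Seek i q, stack_tape s, Suc ?n) = (Delete i (layer s ?n i) q, T ?n, ?n)"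
      by (simp add: fun_upd_idem T_start)
    show ?case by (rule reaches_step) (simp only: eq shift)
  next
    case (step m)
    have "layer s m i \<noteq> None" using step.hyps by (simp add: layer_def)
    then have eq: "astep (sweep ctl) (Seek i q, stack_tape s, Suc m) = (Seek i q, stack_tape s, Suc (Suc m))"
      by (simp add: fun_upd_idem)
    show ?case by (rule reaches_step) (simp only: eq step.IH)
  qed
  from this[of 0] show ?thesis by (simp add: s'_def)
qed

lemma sweep_simulates:
  assumes "ctl q (tops s) = Some (q', p)"
  shows "reaches (astep (sweep ctl)) (astep (sweep ctl) (Look q, stack_tape s, 1))
           (Look q', stack_tape (apply_op p s), 1)"
proof (cases p)
  case Nop
  have "astep (sweep ctl) (Look q, stack_tape s, 1) = (Look q', stack_tape s, 1)"
    using assms Nop by (simp add: fun_upd_idem)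
  then show ?thesis using Nop by simp
next
  case (Push i a)
  have "astep (sweep ctl) (Look q, stack_tape s, 1) = (Insert i a q', stack_tape s, 1)"
    using assms Push by (simp add: fun_upd_idem)
  then show ?thesis by (simp only: Push apply_op.simps sweep_insert)
next
  case (Pop i)
  have "astep (sweep ctl) (Look q, stack_tape s, 1) = (Seek i q', stack_tape s, 1)"
    using assms Pop by (simp add: fun_upd_idem)
  then show ?thesis by (simp only: Pop apply_op.simps sweep_delete)
qed

lemma sweep_halts:
  "halts (sstep ctl) (shalted ctl) (q, s) \<longleftrightarrow>
   halts (astep (sweep ctl)) (ahalted (sweep ctl)) (Look q, stack_tape s, 1)"
proof (rule halts_simulation[where R = "\<lambda>a b. b = (Look (fst a), stack_tape (snd a), 1)"])
  show "ahalted (sweep ctl) b \<Longrightarrow> astep (sweep ctl) b = b" for b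
    by (cases b) simp
  show "shalted ctl a \<longleftrightarrow> ahalted (sweep ctl) b" if "b = (Look (fst a), stack_tape (snd a), 1)" for a b
    using that by (cases a) (auto split: option.splits op.splits)
  show "\<exists>b'. reaches (astep (sweep ctl)) (astep (sweep ctl) b) b' \<and>
          b' = (Look (fst (sstep ctl a)), stack_tape (snd (sstep ctl a)), 1)"
    if b: "b = (Look (fst a), stack_tape (snd a), 1)" and nh: "\<not> shalted ctl a" for a b
  proof (cases a)
    case (Pair q s)
    then obtain q' p where "ctl q (tops s) = Some (q', p)" using nh by auto
    then show ?thesis using sweep_simulates[of ctl q s q' p] b Pair by simp
  qed
qed simp

section \<open>Recognition by stack machines\<close>

definition cells :: "'b set \<Rightarrow> ('i \<Rightarrow> 'b option) set" where
  "cells \<Gamma> = {t. \<forall>i. t i \<in> insert None (Some ` \<Gamma>)}"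

fun op_within :: "'b set \<Rightarrow> ('i, 'b) op \<Rightarrow> bool" where
  "op_within \<Gamma> (Push i a) \<longleftrightarrow> a \<in> \<Gamma>"
| "op_within \<Gamma> _ \<longleftrightarrow> True"

lemma finite_cells:
  assumes "finite \<Gamma>"
  shows "finite (cells \<Gamma> :: ('i::finite \<Rightarrow> 'b option) set)"
proof -
  have "finite {t :: 'i \<Rightarrow> 'b option. \<forall>i. (i \<in> UNIV \<longrightarrow> t i \<in> insert None (Some ` \<Gamma>)) \<and> (i \<notin> UNIV \<longrightarrow> t i = None)}"
    using assms by (intro finite_set_of_finite_funs) auto
  then show ?thesis by (simp add: cells_def)
qed

lemma cells_entry: "t \<in> cells \<Gamma> \<Longrightarrow> t i = Some a \<Longrightarrow> a \<in> \<Gamma>"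
  unfolding cells_def by (auto dest: spec[of _ i])

lemma push_entry_within:
  "t \<in> cells \<Gamma> \<Longrightarrow> op_within \<Gamma> (case t i of None \<Rightarrow> Nop | Some a \<Rightarrow> Push j a)"
  using cells_entry[of t \<Gamma> i] by (auto split: option.split)

text \<open>
  A tape cell is the tuple of the entries of all stacks at one depth. The initial tape of a Turing
  machine and the tape that encodes the input as the only nonempty stack coincide, once the
  tuple that has the letter \<open>a\<close> on track \<open>inp\<close> and nothing else is identified with \<open>a\<close>.
\<close>

theorem stack_machine_recognizable:
  fixes \<Sigma> :: "'a set" and ctl :: "('q, 'i::finite, 'b) control" and letter :: "'a \<Rightarrow> 'b" and inp :: 'i
  assumes "finite Q" "finite \<Gamma>" "q0 \<in> Q" "letter ` \<Sigma> \<subseteq> \<Gamma>" "inj_on letter \<Sigma>"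
    and closed: "\<And>q t q' p. q \<in> Q \<Longrightarrow> t \<in> cells \<Gamma> \<Longrightarrow> ctl q t = Some (q', p) \<Longrightarrow> q' \<in> Q \<and> op_within \<Gamma> p"
  shows "\<exists>M. pf_tm \<Sigma> M \<and> (\<forall>x\<in>lists \<Sigma>. (\<exists>t. halts_accepting M (run M x t)) \<longleftrightarrow>
           halts (sstep ctl) (shalted ctl) (q0, (\<lambda>_. [])(inp := map letter x)))"
proof -
  define P :: "('q, 'i, 'b) phase set" where
    "P = Look ` Q \<union> (\<lambda>(i, a, q). Insert i a q) ` (UNIV \<times> \<Gamma> \<times> Q) \<union> Back ` Q \<union>
         (\<lambda>(i, q). Seek i q) ` (UNIV \<times> Q) \<union>
         (\<lambda>(i, a, q). Delete i a q) ` (UNIV \<times> insert None (Some ` \<Gamma>) \<times> Q)"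
  have P_simps: "Look q \<in> P \<longleftrightarrow> q \<in> Q" "Insert i a q \<in> P \<longleftrightarrow> a \<in> \<Gamma> \<and> q \<in> Q" "Back q \<in> P \<longleftrightarrow> q \<in> Q"
    "Seek i q \<in> P \<longleftrightarrow> q \<in> Q" "Delete i c q \<in> P \<longleftrightarrow> c \<in> insert None (Some ` \<Gamma>) \<and> q \<in> Q" for i a c q
    by (auto simp: P_def image_iff)
  have [simp]: "finite P" using assms(1,2) by (auto simp: P_def)
  have upd: "t(i := c) \<in> cells \<Gamma>" if "t \<in> cells \<Gamma>" "c \<in> insert None (Some ` \<Gamma>)" for t :: "'i \<Rightarrow> 'b option" and i c
    using that by (auto simp: cells_def)
  let ?blank = "(\<lambda>_. None) :: 'i \<Rightarrow> 'b option"
  let ?cell = "\<lambda>a. ?blank(inp := Some (letter a))"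
  have "\<exists>M. pf_tm \<Sigma> M \<and> (\<forall>x\<in>lists \<Sigma>. (\<exists>t. halts_accepting M (run M x t)) \<longleftrightarrow>
          halts (astep (sweep ctl)) (ahalted (sweep ctl)) (Look q0, input_tape ?blank ?cell x, 0))"
  proof (rule machine_renaming[where Q = P and C = "cells \<Gamma>"])
    show "finite (cells \<Gamma> :: ('i \<Rightarrow> 'b option) set)" by (rule finite_cells) fact
    show "Look q0 \<in> P" using assms(3) by (simp add: P_simps)
    show "?blank \<in> cells \<Gamma>" "?cell ` \<Sigma> \<subseteq> cells \<Gamma>" using assms(4) by (auto simp: cells_def image_subset_iff)
    show "inj_on ?cell \<Sigma>" using assms(5) by (auto simp: inj_on_def fun_upd_eqD dest: fun_upd_eqD)
    show "?blank \<notin> ?cell ` \<Sigma>" by (auto dest!: fun_cong[where x = inp])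
    fix p a p' b m
    assume p: "p \<in> P" and a: "a \<in> insert None (Some ` cells \<Gamma>)" and sw: "sweep ctl p a = Some (p', b, m)"
    show "p' \<in> P \<and> b \<in> insert None (Some ` cells \<Gamma>) \<and> (b = None \<longleftrightarrow> a = None)"
    proof (cases a)
      case None
      then show ?thesis using p sw by (cases p) (auto simp: P_simps)
    next
      case (Some t)
      then have t: "t \<in> cells \<Gamma>" using a by auto
      have entry: "t i \<in> insert None (Some ` \<Gamma>)" for i using t by (simp add: cells_def)
      have pushed: "a \<in> \<Gamma>" if "q \<in> Q" "ctl q t = Some (q', Push i a)" for q q' i a
        using closed[OF that(1) t that(2)] by simp
      have target: "q' \<in> Q" if "q \<in> Q" "ctl q t = Some (q', o')" for q q' o'
        using closed[OF that(1) t that(2)] by simp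
      show ?thesis
      proof (cases p)
        case (Look q)
        then show ?thesis
          using p sw t Some target[of q] pushed[of q] by (auto simp: P_simps split: option.splits op.splits)
      next
        case (Insert i c q)
        then show ?thesis
          using p sw Some cells_entry[OF t, of i] upd[OF t, of "Some c" i]
          by (auto simp: P_simps split: option.splits)
      next
        case (Back q)
        then show ?thesis using p sw t Some by (auto simp: P_simps)
      next
        case (Seek i q)
        then show ?thesis using p sw t Some by (auto simp: P_simps split: if_splits)
      next
        case (Delete i c q)
        have "p' = Delete i (t i) q" "b = Some (t(i := c))" using sw Some Delete by simp_all
        moreover have "t(i := c) \<in> cells \<Gamma>" by (rule upd[OF t]) (use p Delete in \<open>simp add: P_simps\<close>)
        ultimately show ?thesis using p Delete Some entry[of i] by (simp add: P_simps)
      qed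
    qed
  qed simp
  then obtain M where M: "pf_tm \<Sigma> M" and run: "\<And>x. x \<in> lists \<Sigma> \<Longrightarrow> (\<exists>t. halts_accepting M (run M x t)) \<longleftrightarrow>
      halts (astep (sweep ctl)) (ahalted (sweep ctl)) (Look q0, input_tape ?blank ?cell x, 0)"
    by (elim exE conjE) simp
  have "halts (astep (sweep ctl)) (ahalted (sweep ctl)) (Look q0, input_tape ?blank ?cell x, 0) \<longleftrightarrow>
      halts (sstep ctl) (shalted ctl) (q0, (\<lambda>_. [])(inp := map letter x))" for x
  proof -
    have T: "input_tape ?blank ?cell x = stack_tape ((\<lambda>_. [])(inp := map letter x))"
      by (auto simp: fun_eq_iff input_tape_def stack_tape_def layer_def split: nat.split)
    (* The head starts on the end marker, and the first step takes it to the tops. *)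
    have "astep (sweep ctl) (Look q0, stack_tape s, 0) = (Look q0, stack_tape s, 1)" for s
      by (simp add: fun_upd_idem)
    then have "halts (astep (sweep ctl)) (ahalted (sweep ctl)) (Look q0, stack_tape s, 0) \<longleftrightarrow>
        halts (astep (sweep ctl)) (ahalted (sweep ctl)) (Look q0, stack_tape s, 1)" for s
      using halts_step_iff[of "ahalted (sweep ctl)" "(Look q0, stack_tape s, 0)" "astep (sweep ctl)"] by simp
    then show ?thesis by (simp add: T sweep_halts)
  qed
  then show ?thesis using M run by (intro exI[of _ M]) simp
qed



section \<open>While programs over stacks\<close>

datatype ('i, 'b) com =
    Skip
  | Do "('i \<Rightarrow> 'b option) \<Rightarrow> ('i, 'b) op"
  | Seq "('i, 'b) com" "('i, 'b) com" (infixr \<open>;;\<close> 60)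
  | While "('i \<Rightarrow> 'b option) \<Rightarrow> bool" "('i, 'b) com"

text \<open>
  A program is its own control state: the state is what remains to be executed. A loop whose guard
  is false has no successor, just like \<open>Skip\<close>, so a main loop halts directly at its head.
\<close>

fun com_step :: "(('i, 'b) com, 'i, 'b) control" where
  "com_step Skip t = None"
| "com_step (Do g) t = Some (Skip, g t)"
| "com_step (c1 ;; c2) t =
     (case com_step c1 t of None \<Rightarrow> Some (c2, Nop) | Some (c, p) \<Rightarrow> Some (c ;; c2, p))"
| "com_step (While b c) t = (if b t then Some (c ;; While b c, Nop) else None)"

text \<open>
  A finite superset of the programs that can remain during the execution of a program. Finiteness
  holds because a loop unfolds to a sequence that ends in the same loop.
\<close>

fun residuals :: "('i, 'b) com \<Rightarrow> ('i, 'b) com set" where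
  "residuals Skip = {Skip}"
| "residuals (Do g) = {Do g, Skip}"
| "residuals (c1 ;; c2) = (\<lambda>c. c ;; c2) ` residuals c1 \<union> residuals c2"
| "residuals (While b c) = insert (While b c) ((\<lambda>c'. c' ;; While b c) ` residuals c)"

fun com_within :: "'b set \<Rightarrow> ('i, 'b) com \<Rightarrow> bool" where
  "com_within \<Gamma> Skip \<longleftrightarrow> True"
| "com_within \<Gamma> (Do g) \<longleftrightarrow> (\<forall>t\<in>cells \<Gamma>. op_within \<Gamma> (g t))"
| "com_within \<Gamma> (c1 ;; c2) \<longleftrightarrow> com_within \<Gamma> c1 \<and> com_within \<Gamma> c2"
| "com_within \<Gamma> (While b c) \<longleftrightarrow> com_within \<Gamma> c"

lemma finite_residuals: "finite (residuals c)"
  by (induction c) auto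

lemma residuals_refl: "c \<in> residuals c"
  by (induction c) auto

lemma residuals_step:
  "c' \<in> residuals c \<Longrightarrow> com_step c' t = Some (c'', p) \<Longrightarrow> c'' \<in> residuals c"
proof (induction c arbitrary: c' c'' p)
  case (Seq c1 c2)
  show ?case
  proof (cases "c' \<in> residuals c2")
    case True
    then have "c'' \<in> residuals c2" using Seq.IH(2) Seq.prems(2) by blast
    then show ?thesis by simp
  next
    case False
    then obtain d where d: "c' = d ;; c2" "d \<in> residuals c1" using Seq.prems(1) by auto
    then show ?thesis
      using Seq.prems(2) Seq.IH(1)[OF d(2)] by (auto simp: residuals_refl split: option.splits)
  qed
next
  case (While b c)
  show ?case
  proof (cases "c' = While b c")
    case True
    then show ?thesis using While.prems(2) by (auto simp: residuals_refl split: if_splits)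
  next
    case False
    then obtain d where d: "c' = d ;; While b c" "d \<in> residuals c" using While.prems(1) by auto
    then show ?thesis
      using While.prems(2) While.IH[OF d(2)] by (auto split: option.splits)
  qed
qed auto

lemma com_within_residuals: "com_within \<Gamma> c \<Longrightarrow> c' \<in> residuals c \<Longrightarrow> com_within \<Gamma> c'"
proof (induction c arbitrary: c')
  case (Do g)
  then show ?case by auto
next
  case (Seq c1 c2)
  from Seq.prems(2) consider d where "c' = d ;; c2" "d \<in> residuals c1" | "c' \<in> residuals c2" by auto
  then show ?case
  proof cases
    case 1
    then show ?thesis using Seq.IH(1)[of d] Seq.prems(1) by simp
  next
    case 2
    then show ?thesis using Seq.IH(2)[of c'] Seq.prems(1) by simp
  qed
next
  case (While b c)
  from While.prems(2) consider "c' = While b c" | d where "c' = d ;; While b c" "d \<in> residuals c" by auto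
  then show ?case
  proof cases
    case 1
    then show ?thesis using While.prems(1) by simp
  next
    case 2
    then show ?thesis using While.IH[of d] While.prems(1) by simp
  qed
qed simp

lemma op_within_com_step:
  "com_within \<Gamma> c \<Longrightarrow> t \<in> cells \<Gamma> \<Longrightarrow> com_step c t = Some (c', p) \<Longrightarrow> op_within \<Gamma> p"
proof (induction c arbitrary: c')
  case (Seq c1 c2)
  show ?case
  proof (cases "com_step c1 t")
    case None
    then show ?thesis using Seq.prems(3) by simp
  next
    case (Some dp)
    then show ?thesis using Seq.prems Seq.IH(1)[of "fst dp"] by (cases dp) simp
  qed
qed (auto split: if_splits)

theorem program_recognizable:
  fixes c :: "('i::finite, 'b) com" and letter :: "'a \<Rightarrow> 'b"
  assumes "finite \<Gamma>" "letter ` \<Sigma> \<subseteq> \<Gamma>" "inj_on letter \<Sigma>" "com_within \<Gamma> c"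
  shows "\<exists>M. pf_tm \<Sigma> M \<and> (\<forall>x\<in>lists \<Sigma>. (\<exists>t. halts_accepting M (run M x t)) \<longleftrightarrow>
           halts (sstep com_step) (shalted com_step) (c, (\<lambda>_. [])(inp := map letter x)))"
proof (rule stack_machine_recognizable[where Q = "residuals c" and \<Gamma> = \<Gamma>])
  show "finite (residuals c)" by (rule finite_residuals)
  show "c \<in> residuals c" by (rule residuals_refl)
  fix q q' :: "('i, 'b) com" and t p
  assume "q \<in> residuals c" "t \<in> cells \<Gamma>" "com_step q t = Some (q', p)"
  then show "q' \<in> residuals c \<and> op_within \<Gamma> p"
    using residuals_step[of q c t q' p] op_within_com_step[OF com_within_residuals[OF assms(4)], of q t q' p] by simp
qed (use assms in auto)

text \<open>
  The final program of an execution need not be \<open>Skip\<close>; it is any program that cannot continue.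
\<close>

definition exec :: "('i, 'b) com \<Rightarrow> ('i \<Rightarrow> 'b list) \<Rightarrow> ('i \<Rightarrow> 'b list) \<Rightarrow> bool" where
  "exec c s s' \<longleftrightarrow> (\<exists>c'. reaches (sstep com_step) (c, s) (c', s') \<and> com_step c' (tops s') = None)"

text \<open>
  An execution of \<open>c\<close> can be replayed in front of \<open>d\<close>. Steps at which \<open>c\<close> has already halted
  are skipped, since there \<open>c ;; d\<close> would move on to \<open>d\<close>.
\<close>

lemma reaches_Seq:
  assumes "reaches (sstep com_step) (c, s) (c', s')"
  shows "reaches (sstep com_step) (c ;; d, s) (c' ;; d, s')"
proof -
  obtain n where "(sstep com_step ^^ n) (c, s) = (c', s')" using assms by (auto simp: reaches_def)
  then show ?thesis
  proof (induction n arbitrary: c s)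
    case 0
    then have "c = c' \<and> s = s'" by simp
    then show ?case by simp
  next
    case (Suc n)
    show ?case
    proof (cases "com_step c (tops s)")
      case None
      then have "sstep com_step (c, s) = (c, s)" by simp
      then have "(sstep com_step ^^ n) (c, s) = (c', s')"
        using Suc.prems by (simp only: funpow_Suc_right comp_apply)
      then show ?thesis by (rule Suc.IH)
    next
      case (Some cp)
      obtain c1 p where cp: "cp = (c1, p)" by (cases cp)
      have one: "sstep com_step (c, s) = (c1, apply_op p s)"
        and two: "sstep com_step (c ;; d, s) = (c1 ;; d, apply_op p s)" using Some cp by simp_all
      have "(sstep com_step ^^ n) (c1, apply_op p s) = (c', s')"
        using Suc.prems by (simp only: funpow_Suc_right comp_apply one)
      then have "reaches (sstep com_step) (c1 ;; d, apply_op p s) (c' ;; d, s')" by (rule Suc.IH)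
      then have "reaches (sstep com_step) (sstep com_step (c ;; d, s)) (c' ;; d, s')" by (simp only: two)
      then show ?thesis by (rule reaches_step)
    qed
  qed
qed

lemma exec_Skip: "exec Skip s s"
  unfolding exec_def by (intro exI[of _ Skip]) simp

lemma exec_Do: "s' = apply_op (g (tops s)) s \<Longrightarrow> exec (Do g) s s'"
  unfolding exec_def by (intro exI[of _ Skip] conjI, rule reaches_step) simp_all

lemma exec_reaches:
  assumes "exec c s s'"
  shows "reaches (sstep com_step) (c ;; d, s) (d, s')"
proof -
  obtain c' where c': "reaches (sstep com_step) (c, s) (c', s')" "com_step c' (tops s') = None"
    using assms by (auto simp: exec_def)
  have "reaches (sstep com_step) (c' ;; d, s') (d, s')"
    by (rule reaches_step) (simp add: c'(2))
  with reaches_Seq[OF c'(1)] show ?thesis by (rule reaches_trans)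
qed

lemma exec_Seq:
  assumes "exec c s s'" "exec d s' s''"
  shows "exec (c ;; d) s s''"
proof -
  obtain d' where d': "reaches (sstep com_step) (d, s') (d', s'')" "com_step d' (tops s'') = None"
    using assms(2) by (auto simp: exec_def)
  have "reaches (sstep com_step) (c ;; d, s) (d', s'')"
    using exec_reaches[OF assms(1)] d'(1) by (rule reaches_trans)
  then show ?thesis using d'(2) unfolding exec_def by (intro exI[of _ d'] conjI)
qed

lemma While_unfold: "b (tops s) \<Longrightarrow> sstep com_step (While b c, s) = (c ;; While b c, s)"
  by simp

lemma exec_While_False: "\<not> b (tops s) \<Longrightarrow> exec (While b c) s s"
  unfolding exec_def by (intro exI[of _ "While b c"]) simp

lemma exec_While_True:
  assumes "b (tops s)" "exec c s s'" "exec (While b c) s' s''"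
  shows "exec (While b c) s s''"
proof -
  obtain d where d: "reaches (sstep com_step) (c ;; While b c, s) (d, s'')" "com_step d (tops s'') = None"
    using exec_Seq[OF assms(2,3)] by (auto simp: exec_def)
  have "reaches (sstep com_step) (While b c, s) (d, s'')"
    by (rule reaches_step) (simp only: While_unfold[of b, OF assms(1)] d(1))
  then show ?thesis using d(2) unfolding exec_def by (intro exI[of _ d] conjI)
qed

text \<open>
  The rule for a loop that need not terminate: its body implements one step of an abstract system
  \<open>f\<close> that runs until \<open>H\<close>.
\<close>

lemma halts_While:
  fixes c :: "('i, 'b) com"
  assumes body: "\<And>a s. R a s \<Longrightarrow> b (tops s) \<Longrightarrow> \<exists>s'. exec c s s' \<and> R (f a) s'"
    and guard: "\<And>a s. R a s \<Longrightarrow> H a \<longleftrightarrow> \<not> b (tops s)"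
    and "R a s"
  shows "halts f H a \<longleftrightarrow> halts (sstep com_step) (shalted com_step) (While b c, s)"
proof (rule halts_simulation[where R = "\<lambda>a q. \<exists>s. q = (While b c, s) \<and> R a s"])
  show "shalted com_step q \<Longrightarrow> sstep com_step q = q" for q :: "('i, 'b) com \<times> ('i \<Rightarrow> 'b list)"
    by (cases q) simp
  show "H a \<longleftrightarrow> shalted com_step q" if "\<exists>s. q = (While b c, s) \<and> R a s" for a q
    using that guard by auto
  show "\<exists>q'. reaches (sstep com_step) (sstep com_step q) q' \<and> (\<exists>s. q' = (While b c, s) \<and> R (f a) s)"
    if q: "\<exists>s. q = (While b c, s) \<and> R a s" and nh: "\<not> H a" for a q
  proof -
    obtain s where s: "q = (While b c, s)" "R a s" using q by blast
    have bs: "b (tops s)" using guard[OF s(2)] nh by simp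
    obtain s' where s': "exec c s s'" "R (f a) s'" using body[OF s(2) bs] by blast
    have "reaches (sstep com_step) (sstep com_step q) (While b c, s')"
      unfolding s(1) While_unfold[of b, OF bs] by (rule exec_reaches[OF s'(1)])
    then show ?thesis using s'(2) by (intro exI[of _ "(While b c, s')"] conjI exI[of _ s'] refl)
  qed
  show "\<exists>s'. (While b c, s) = (While b c, s') \<and> R a s'" using \<open>R a s\<close> by simp
qed

definition push :: "'i \<Rightarrow> 'b \<Rightarrow> ('i, 'b) com" where
  "push i a = Do (\<lambda>_. Push i a)"

definition pop :: "'i \<Rightarrow> ('i, 'b) com" where
  "pop i = Do (\<lambda>_. Pop i)"

definition copy :: "'i \<Rightarrow> 'i \<Rightarrow> ('i, 'b) com" where
  "copy i j = Do (\<lambda>t. case t i of None \<Rightarrow> Nop | Some a \<Rightarrow> Push j a)"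

definition pour_while :: "('b \<Rightarrow> bool) \<Rightarrow> 'i \<Rightarrow> 'i \<Rightarrow> ('i, 'b) com" where
  "pour_while P i j = While (\<lambda>t. \<exists>a. t i = Some a \<and> P a) (copy i j ;; pop i)"

abbreviation pour :: "'i \<Rightarrow> 'i \<Rightarrow> ('i, 'b) com" where
  "pour \<equiv> pour_while (\<lambda>_. True)"

definition clear :: "'i \<Rightarrow> ('i, 'b) com" where
  "clear i = While (\<lambda>t. t i \<noteq> None) (pop i)"

fun push_all :: "'i \<Rightarrow> 'b list \<Rightarrow> ('i, 'b) com" where
  "push_all i [] = Skip"
| "push_all i (a # as) = push_all i as ;; push i a"

lemma exec_push: "exec (push i a) s (s(i := a # s i))"
  unfolding push_def by (rule exec_Do) simp

lemma exec_pop: "exec (pop i) s (s(i := tl (s i)))"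
  unfolding pop_def by (rule exec_Do) simp

lemma exec_copy: "s i = a # as \<Longrightarrow> exec (copy i j) s (s(j := a # s j))"
  unfolding copy_def by (rule exec_Do) simp

lemma exec_pour_while:
  assumes "i \<noteq> j"
  shows "exec (pour_while P i j) s (s(i := dropWhile P (s i), j := rev (takeWhile P (s i)) @ s j))"
proof (induction "s i" arbitrary: s)
  case Nil
  note si = Nil[symmetric]
  have idle: "s(i := dropWhile P (s i), j := rev (takeWhile P (s i)) @ s j) = s"
    by (simp add: si fun_upd_idem)
  show ?case unfolding idle pour_while_def by (rule exec_While_False) (simp add: si)
next
  case (Cons a as)
  note si = Cons.hyps(2)[symmetric]
  show ?case
  proof (cases "P a")
    case False
    with si have idle: "s(i := dropWhile P (s i), j := rev (takeWhile P (s i)) @ s j) = s"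
      by (simp add: fun_upd_idem)
    show ?thesis unfolding idle pour_while_def by (rule exec_While_False) (simp add: si False)
  next
    case True
    let ?s = "s(j := a # s j, i := as)"
    have step: "exec (copy i j ;; pop i) s ?s"
      using exec_Seq[OF exec_copy[of s i a as j, OF si] exec_pop[of i]] si assms by simp
    have "exec (pour_while P i j) ?s (?s(i := dropWhile P (?s i), j := rev (takeWhile P (?s i)) @ ?s j))"
      using assms by (intro Cons.hyps(1)) simp
    moreover have "?s(i := dropWhile P (?s i), j := rev (takeWhile P (?s i)) @ ?s j) =
        s(i := dropWhile P (s i), j := rev (takeWhile P (s i)) @ s j)"
      by (rule ext) (simp add: True si assms assms[symmetric])
    ultimately have rest: "exec (pour_while P i j) ?s (s(i := dropWhile P (s i), j := rev (takeWhile P (s i)) @ s j))"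
      by (simp only:)
    show ?thesis
      unfolding pour_while_def by (rule exec_While_True[OF _ step rest[unfolded pour_while_def]]) (simp add: si True)
  qed
qed

lemma exec_pour:
  fixes s :: "'i \<Rightarrow> 'b list"
  assumes "i \<noteq> j"
  shows "exec (pour i j) s (s(i := [], j := rev (s i) @ s j))"
proof -
  have all: "takeWhile (\<lambda>_. True) as = as" "dropWhile (\<lambda>_. True) as = []" for as :: "'b list"
    by (simp_all only: takeWhile_eq_all_conv dropWhile_eq_Nil_conv ball_triv simp_thms)
  show ?thesis using exec_pour_while[OF assms, of "\<lambda>_. True" s] by (simp only: all)
qed

lemma exec_clear: "exec (clear i) s (s(i := []))"
proof (induction "s i" arbitrary: s)
  case Nil
  note si = Nil[symmetric]
  have idle: "s(i := []) = s" by (simp add: si fun_upd_idem)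
  show ?case unfolding idle clear_def by (rule exec_While_False) (simp add: si)
next
  case (Cons a as)
  note si = Cons.hyps(2)[symmetric]
  have "exec (clear i) (s(i := as)) ((s(i := as))(i := []))" by (rule Cons.hyps(1)) simp
  then have rest: "exec (clear i) (s(i := as)) (s(i := []))" by simp
  have step: "exec (pop i) s (s(i := as))" using exec_pop[of i s] si by simp
  show ?case
    unfolding clear_def by (rule exec_While_True[OF _ step rest[unfolded clear_def]]) (simp add: si)
qed

lemma exec_push_all: "exec (push_all i as) s (s(i := as @ s i))"
proof (induction as)
  case Nil
  show ?case by (simp add: exec_Skip fun_upd_idem)
next
  case (Cons a as)
  from exec_Seq[OF Cons.IH exec_push[of i a]] show ?case
    by (simp only: push_all.simps fun_upd_upd fun_upd_same append_Cons)
qed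

lemma com_within_copy: "com_within \<Gamma> (copy i j)"
  by (simp add: copy_def push_entry_within)

lemma com_within_push: "a \<in> \<Gamma> \<Longrightarrow> com_within \<Gamma> (push i a)"
  by (simp add: push_def)

lemma com_within_macros:
  "com_within \<Gamma> (pop i)" "com_within \<Gamma> (pour_while P i j)" "com_within \<Gamma> (clear i)"
  "com_within \<Gamma> (copy i j)"
  by (simp_all add: pop_def pour_while_def clear_def com_within_copy)

lemma com_within_push_all: "set as \<subseteq> \<Gamma> \<Longrightarrow> com_within \<Gamma> (push_all i as)"
  by (induction as) (simp_all add: com_within_push)

section \<open>Simulating a Turing machine on two stacks\<close>

text \<open>
  \<open>Inp\<close> holds the input. \<open>Todo\<close> and \<open>Done\<close> hold the generators that are still to be applied and
  those already applied. \<open>Lft\<close> and \<open>Rgt\<close> are the tape of the simulated machine: the cells left of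
  its head, nearest first, and the cells from its head onwards. Only the top of \<open>Ctl\<close> matters: it
  is a register that is overwritten by pushing.
\<close>

datatype track = Inp | Todo | Done | Lft | Rgt | Ctl

instance track :: finite
proof
  have "(UNIV :: track set) \<subseteq> {Inp, Todo, Done, Lft, Rgt, Ctl}"
    using track.exhaust by auto
  then show "finite (UNIV :: track set)" by (rule finite_subset) simp
qed

text \<open>
  The stack alphabet: symbols of a simulated tape, indices of generators, a state \<open>q\<close> of machine
  \<open>d\<close>, a pending action of machine \<open>d\<close> (new state, written symbol, movement), and the verdicts of
  the comparison with the input.
\<close>

datatype 'a stk = Sy "'a symb" | Digit nat | St nat nat | Act nat nat "'a symb" move | Accept | Reject

fun stacks :: "'b list \<Rightarrow> 'b list \<Rightarrow> 'b list \<Rightarrow> 'b list \<Rightarrow> 'b list \<Rightarrow> 'b list \<Rightarrow> track \<Rightarrow> 'b list" where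
  "stacks x u v l r k Inp = x"
| "stacks x u v l r k Todo = u"
| "stacks x u v l r k Done = v"
| "stacks x u v l r k Lft = l"
| "stacks x u v l r k Rgt = r"
| "stacks x u v l r k Ctl = k"

lemma stacks_upd [simp]:
  "(stacks x u v l r k)(Inp := y) = stacks y u v l r k"
  "(stacks x u v l r k)(Todo := y) = stacks x y v l r k"
  "(stacks x u v l r k)(Done := y) = stacks x u y l r k"
  "(stacks x u v l r k)(Lft := y) = stacks x u v y r k"
  "(stacks x u v l r k)(Rgt := y) = stacks x u v l y k"
  "(stacks x u v l r k)(Ctl := y) = stacks x u v l r y"
  by (rule ext, rename_tac i, case_tac i, simp_all)+

definition action :: "(nat \<Rightarrow> 'a tm) \<Rightarrow> (track \<Rightarrow> 'a stk option) \<Rightarrow> 'a stk option" where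
  "action M t = (case t Ctl of
     Some (St d q) \<Rightarrow>
       map_option (\<lambda>(q', b, m). Act d q' b m)
         (tm_delta (M d) q (case t Rgt of Some (Sy a) \<Rightarrow> a | _ \<Rightarrow> Blank))
   | _ \<Rightarrow> None)"

definition obey :: "((track \<Rightarrow> 'a stk option) \<Rightarrow> nat \<Rightarrow> nat \<Rightarrow> 'a symb \<Rightarrow> move \<Rightarrow> (track, 'a stk) op) \<Rightarrow>
    (track, 'a stk) com" where
  "obey h = Do (\<lambda>t. case t Ctl of Some (Act d q b m) \<Rightarrow> h t d q b m | _ \<Rightarrow> Nop)"

text \<open>
  The action is put on \<open>Ctl\<close> first, because the later operations change the scanned symbol that
  determines it. Popping the empty stack \<open>Rgt\<close> is harmless: it stands for blanks only. A move to
  the left on the end marker finds \<open>Lft\<close> empty and leaves the head in place, as required.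
\<close>

definition tm_step :: "(nat \<Rightarrow> 'a tm) \<Rightarrow> (track, 'a stk) com" where
  "tm_step M =
     Do (\<lambda>t. case action M t of None \<Rightarrow> Nop | Some a \<Rightarrow> Push Ctl a) ;;
     pop Rgt ;;
     obey (\<lambda>t d q b m. Push Rgt (Sy b)) ;;
     obey (\<lambda>t d q b m. case m of
         MoveLeft \<Rightarrow> (case t Lft of None \<Rightarrow> Nop | Some a \<Rightarrow> Push Rgt a)
       | Stay \<Rightarrow> Nop
       | MoveRight \<Rightarrow> (case t Rgt of None \<Rightarrow> Nop | Some a \<Rightarrow> Push Lft a)) ;;
     obey (\<lambda>t d q b m. case m of MoveLeft \<Rightarrow> Pop Lft | Stay \<Rightarrow> Nop | MoveRight \<Rightarrow> Pop Rgt) ;;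
     obey (\<lambda>t d q b m. Push Ctl (St d q))"

definition simulate :: "(nat \<Rightarrow> 'a tm) \<Rightarrow> (track, 'a stk) com" where
  "simulate M = While (\<lambda>t. action M t \<noteq> None) (tm_step M)"

definition pad :: "'a stk list \<Rightarrow> nat \<Rightarrow> 'a stk" where
  "pad r j = (if j < length r then r ! j else Sy Blank)"

lemma pad_simps [simp]: "pad (a # r) 0 = a" "pad (a # r) (Suc j) = pad r j" "pad (tl r) j = pad r (Suc j)"
  by (auto simp: pad_def nth_tl)

text \<open>
  \<open>Rgt\<close> describes an infinite half tape by a finite list, so its end is padded with blanks.
\<close>

definition tape_split :: "'a config \<Rightarrow> 'a stk list \<Rightarrow> 'a stk list \<Rightarrow> bool" where
  "tape_split c l r \<longleftrightarrow>
     l = map (\<lambda>i. Sy (tape c i)) (rev [0..<head c]) \<and> (\<forall>j. pad r j = Sy (tape c (head c + j)))"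

fun left_after :: "move \<Rightarrow> 'a symb \<Rightarrow> 'a stk list \<Rightarrow> 'a stk list" where
  "left_after MoveLeft b l = tl l"
| "left_after Stay b l = l"
| "left_after MoveRight b l = Sy b # l"

fun right_after :: "move \<Rightarrow> 'a symb \<Rightarrow> 'a stk list \<Rightarrow> 'a stk list \<Rightarrow> 'a stk list" where
  "right_after MoveLeft b l r = take 1 l @ Sy b # tl r"
| "right_after Stay b l r = Sy b # tl r"
| "right_after MoveRight b l r = tl r"

text \<open>
  In each case only the scanned cell changes, so the part left of the old head position is
  unaffected by the update (\<open>before\<close>).
\<close>

lemma tape_split_step:
  assumes "tape_split c l r" and delta: "tm_delta M (state c) (tape c (head c)) = Some (q, b, m)"
  shows "tape_split (step M c) (left_after m b l) (right_after m b l r)"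
proof -
  have l: "l = map (\<lambda>i. Sy (tape c i)) (rev [0..<head c])"
    and r: "\<And>j. pad r j = Sy (tape c (head c + j))"
    using assms(1) by (simp_all add: tape_split_def)
  have c': "step M c = \<lparr>state = q, tape = (tape c)(head c := b), head = move_head m (head c)\<rparr>"
    using delta by (simp add: step_def)
  have written: "pad (Sy b # tl r) j = Sy (((tape c)(head c := b)) (head c + j))" for j
    by (cases j) (simp_all add: r)
  have before: "map (\<lambda>i. Sy (((tape c)(head c := b)) i)) (rev [0..<h]) = map (\<lambda>i. Sy (tape c i)) (rev [0..<h])"
    if "h \<le> head c" for h
    using that by (intro map_cong) auto
  show ?thesis
  proof (cases m)
    case MoveLeft
    show ?thesis
    proof (cases "head c")
      case 0
      then show ?thesis using MoveLeft written l by (simp add: tape_split_def c')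
    next
      case (Suc h)
      then have l': "l = Sy (tape c h) # map (\<lambda>i. Sy (tape c i)) (rev [0..<h])" using l by simp
      have "pad (Sy (tape c h) # Sy b # tl r) j = Sy (((tape c)(Suc h := b)) (h + j))" for j
        using written[of "j - 1"] Suc by (cases j) (simp_all del: pad_simps(3))
      then show ?thesis using MoveLeft Suc l' before[of h] by (simp add: tape_split_def c')
    qed
  next
    case Stay
    then show ?thesis using written l before[of "head c"] by (simp add: tape_split_def c')
  next
    case MoveRight
    then show ?thesis using r l before[of "head c"] by (simp add: tape_split_def c')
  qed
qed

lemma action_stacks:
  "action M (tops (stacks x u v l r (St d q # k))) =
     map_option (\<lambda>(q', b, m). Act d q' b m)
       (tm_delta (M d) q (case r of Sy a # _ \<Rightarrow> a | _ \<Rightarrow> Blank))"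
  by (auto simp: action_def split: list.splits stk.splits intro!: arg_cong[where f = "map_option _"])

lemma exec_obey:
  assumes "tops s Ctl = Some (Act d q b m)" "s' = apply_op (h (tops s) d q b m) s"
  shows "exec (obey h) s s'"
  unfolding obey_def using assms(1) by (intro exec_Do) (simp only: assms(2) option.simps stk.simps)

lemma exec_tm_step:
  assumes "tm_delta (M d) q (case r of Sy a # _ \<Rightarrow> a | _ \<Rightarrow> Blank) = Some (q', b, m)"
  shows "\<exists>k'. exec (tm_step M) (stacks x u v l r (St d q # k))
           (stacks x u v (left_after m b l) (right_after m b l r) (St d q' # k'))"
proof -
  let ?k = "Act d q' b m # St d q # k"
  have fetch: "exec (Do (\<lambda>t. case action M t of None \<Rightarrow> Nop | Some a \<Rightarrow> Push Ctl a))
      (stacks x u v l r (St d q # k)) (stacks x u v l r ?k)"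
    by (rule exec_Do) (simp add: action_stacks assms)
  have erase: "exec (pop Rgt) (stacks x u v l r ?k) (stacks x u v l (tl r) ?k)"
    using exec_pop[of Rgt "stacks x u v l r ?k"] by simp
  have put: "exec (obey (\<lambda>t d q b m. Push Rgt (Sy b))) (stacks x u v l (tl r) ?k) (stacks x u v l (Sy b # tl r) ?k)"
    by (rule exec_obey) simp_all
  let ?l = "if m = MoveRight then Sy b # l else l"
  let ?r = "if m = MoveLeft then take 1 l @ Sy b # tl r else Sy b # tl r"
  have carry: "exec (obey (\<lambda>t d q b m. case m of
         MoveLeft \<Rightarrow> (case t Lft of None \<Rightarrow> Nop | Some a \<Rightarrow> Push Rgt a)
       | Stay \<Rightarrow> Nop
       | MoveRight \<Rightarrow> (case t Rgt of None \<Rightarrow> Nop | Some a \<Rightarrow> Push Lft a)))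
     (stacks x u v l (Sy b # tl r) ?k) (stacks x u v ?l ?r ?k)"
    by (rule exec_obey, simp) (cases m; cases l; simp)
  have drop: "exec (obey (\<lambda>t d q b m. case m of MoveLeft \<Rightarrow> Pop Lft | Stay \<Rightarrow> Nop | MoveRight \<Rightarrow> Pop Rgt))
     (stacks x u v ?l ?r ?k) (stacks x u v (left_after m b l) (right_after m b l r) ?k)"
    by (rule exec_obey, simp) (cases m; cases l; simp)
  have enter: "exec (obey (\<lambda>t d q b m. Push Ctl (St d q)))
     (stacks x u v (left_after m b l) (right_after m b l r) ?k)
     (stacks x u v (left_after m b l) (right_after m b l r) (St d q' # ?k))"
    by (rule exec_obey) simp_all
  show ?thesis
    unfolding tm_step_def
    using exec_Seq[OF fetch exec_Seq[OF erase exec_Seq[OF put exec_Seq[OF carry exec_Seq[OF drop enter]]]]]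
    by (rule exI)
qed

lemma tape_split_scan:
  assumes "tape_split c l r"
  shows "(case r of Sy a # _ \<Rightarrow> a | _ \<Rightarrow> Blank) = tape c (head c)"
proof -
  have "pad r 0 = Sy (tape c (head c))" using assms by (simp add: tape_split_def)
  then show ?thesis by (cases r) (simp_all add: pad_def)
qed

lemma exec_simulate:
  assumes "tape_split c l r" "halts_accepting (M d) ((step (M d) ^^ t) c)"
  shows "\<exists>l' r' k'. exec (simulate M) (stacks x u v l r (St d (state c) # k)) (stacks x u v l' r' k') \<and>
           tape_split ((step (M d) ^^ t) c) l' r'"
  using assms
proof (induction t arbitrary: c l r k)
  case 0
  let ?s = "stacks x u v l r (St d (state c) # k)"
  have "action M (tops ?s) = None"
    using 0 tape_split_scan[OF 0(1)] by (simp add: action_stacks halts_accepting_def)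
  then have "exec (simulate M) ?s ?s" unfolding simulate_def by (intro exec_While_False) simp
  moreover have "tape_split ((step (M d) ^^ 0) c) l r" using 0(1) by simp
  ultimately show ?case by (intro exI conjI)
next
  case (Suc t)
  let ?s = "stacks x u v l r (St d (state c) # k)"
  have halted: "halts_accepting (M d) ((step (M d) ^^ t) (step (M d) c))"
    using Suc.prems(2) by (simp only: funpow_Suc_right comp_apply)
  note scan = tape_split_scan[OF Suc.prems(1)]
  show ?case
  proof (cases "tm_delta (M d) (state c) (tape c (head c))")
    case None
    have "step (M d) c = c" using None by (simp add: step_def)
    then have same: "(step (M d) ^^ Suc t) c = (step (M d) ^^ t) c"
      by (simp only: funpow_Suc_right comp_apply)
    show ?thesis unfolding same
      by (rule Suc.IH[OF Suc.prems(1)]) (use halted \<open>step (M d) c = c\<close> in simp)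
  next
    case (Some qbm)
    obtain q b m where qbm: "qbm = (q, b, m)" by (cases qbm)
    have delta: "tm_delta (M d) (state c) (tape c (head c)) = Some (q, b, m)" using Some qbm by simp
    have st: "state (step (M d) c) = q" using delta by (simp add: step_def)
    obtain k1 where one: "exec (tm_step M) ?s (stacks x u v (left_after m b l) (right_after m b l r) (St d q # k1))"
      using exec_tm_step[of M d "state c" r q b m x u v l k] delta scan by auto
    obtain l' r' k' where rest: "exec (simulate M)
        (stacks x u v (left_after m b l) (right_after m b l r) (St d q # k1)) (stacks x u v l' r' k')"
      and split: "tape_split ((step (M d) ^^ t) (step (M d) c)) l' r'"
      using Suc.IH[OF tape_split_step[OF Suc.prems(1) delta] halted, of k1] st by auto
    have "action M (tops ?s) \<noteq> None" using delta scan by (simp add: action_stacks)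
    then have "exec (simulate M) ?s (stacks x u v l' r' k')"
      unfolding simulate_def by (rule exec_While_True[OF _ one rest[unfolded simulate_def]])
    moreover have "tape_split ((step (M d) ^^ Suc t) c) l' r'"
      using split by (simp only: funpow_Suc_right comp_apply)
    ultimately show ?thesis by (intro exI conjI)
  qed
qed

definition word_tape :: "'a list \<Rightarrow> 'a stk list" where
  "word_tape w = Sy LeftEnd # map (\<lambda>a. Sy (Letter a)) w"

lemma tape_split_initial: "tape_split (initial_config M w) [] (word_tape w)"
proof -
  have "pad (word_tape w) j = Sy (tape (initial_config M w) j)" for j
    by (cases j) (auto simp: pad_def word_tape_def initial_config_def)
  then show ?thesis by (simp add: tape_split_def initial_config_def)
qed

text \<open>
  The output together with the end marker is the maximal blank-free prefix of the tape. The list is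
  long enough to contain it, since padding contributes blanks only.
\<close>

lemma tape_split_output:
  assumes "tape_split c l r" "has_output c y"
  shows "takeWhile (\<lambda>a. a \<noteq> Sy Blank) (rev l @ r) = word_tape y"
proof -
  let ?w = "rev l @ r" and ?n = "Suc (length y)"
  have l: "l = map (\<lambda>i. Sy (tape c i)) (rev [0..<head c])" and r: "\<And>j. pad r j = Sy (tape c (head c + j))"
    using assms(1) by (simp_all add: tape_split_def)
  have w: "pad ?w j = Sy (tape c j)" for j
  proof (cases "j < head c")
    case True
    then show ?thesis by (simp add: l pad_def nth_append rev_map)
  next
    case False
    then have "j - head c < length r \<longleftrightarrow> j < length ?w" by (simp add: l less_diff_conv2 add.commute)
    then have "pad ?w j = pad r (j - head c)" using False by (simp add: l pad_def nth_append rev_map)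
    then show ?thesis using r[of "j - head c"] False by simp
  qed
  have out: "tape c j = (if j = 0 then LeftEnd else Letter (y ! (j - 1)))" if "j < ?n" for j
    using assms(2) that by (cases j) (auto simp: has_output_def)
  have nonblank: "pad ?w j \<noteq> Sy Blank" if "j < ?n" for j
    using out[OF that] by (simp add: w)
  have len: "?n \<le> length ?w"
  proof (rule ccontr)
    assume "\<not> ?n \<le> length ?w"
    then have "length ?w < ?n" by simp
    from nonblank[OF this] show False by (simp add: pad_def)
  qed
  have end_blank: "pad ?w ?n = Sy Blank"
    using assms(2) by (simp only: w has_output_def)
  have "takeWhile (\<lambda>a. a \<noteq> Sy Blank) ?w = take ?n ?w"
  proof (rule takeWhile_eq_take_P_nth)
    fix i assume "i < ?n" "i < length ?w"
    then show "?w ! i \<noteq> Sy Blank" using nonblank[of i] by (simp only: pad_def if_True simp_thms)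
  next
    assume "?n < length ?w"
    then show "\<not> ?w ! ?n \<noteq> Sy Blank" using end_blank by (simp only: pad_def if_True simp_thms)
  qed
  also have "\<dots> = word_tape y"
  proof (rule nth_equalityI)
    show "length (take ?n ?w) = length (word_tape y)" using len by (simp add: word_tape_def)
    fix i assume "i < length (take ?n ?w)"
    then have i: "i < ?n" "i < length ?w" by simp_all
    then have "take ?n ?w ! i = pad ?w i" by (simp only: nth_take pad_def if_True)
    also have "\<dots> = word_tape y ! i" using out[OF i(1)] i(1) by (cases i) (simp_all add: w word_tape_def)
    finally show "take ?n ?w ! i = word_tape y ! i" .
  qed
  finally show ?thesis .
qed

text \<open>
  After the simulation the head may be anywhere and arbitrary symbols may follow the output.
  Rewinding puts the whole tape on \<open>Rgt\<close>; the output is then saved on \<open>Lft\<close>, the remainder is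
  erased, and the output is put back as the initial tape for the next generator.
\<close>

definition apply_generator :: "(nat \<Rightarrow> 'a tm) \<Rightarrow> (track, 'a stk) com" where
  "apply_generator M =
     Do (\<lambda>t. case t Todo of Some (Digit d) \<Rightarrow> Push Ctl (St d (tm_start (M d))) | _ \<Rightarrow> Nop) ;;
     copy Todo Done ;; pop Todo ;;
     simulate M ;;
     pour Lft Rgt ;; pour_while (\<lambda>a. a \<noteq> Sy Blank) Rgt Lft ;; clear Rgt ;; pour Lft Rgt"

lemma exec_apply_generator:
  assumes "halts_accepting (M d) (run (M d) w t)" "has_output (run (M d) w t) w'"
  shows "\<exists>k'. exec (apply_generator M) (stacks x (Digit d # u) v [] (word_tape w) k)
           (stacks x u (Digit d # v) [] (word_tape w') k')"
proof -
  let ?k = "St d (tm_start (M d)) # k"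
  have load: "exec (Do (\<lambda>t. case t Todo of Some (Digit d) \<Rightarrow> Push Ctl (St d (tm_start (M d))) | _ \<Rightarrow> Nop))
      (stacks x (Digit d # u) v [] (word_tape w) k) (stacks x (Digit d # u) v [] (word_tape w) ?k)"
    by (rule exec_Do) simp
  have keep: "exec (copy Todo Done) (stacks x (Digit d # u) v [] (word_tape w) ?k)
      (stacks x (Digit d # u) (Digit d # v) [] (word_tape w) ?k)"
    using exec_copy[of "stacks x (Digit d # u) v [] (word_tape w) ?k" Todo "Digit d" u Done] by simp
  have drop: "exec (pop Todo) (stacks x (Digit d # u) (Digit d # v) [] (word_tape w) ?k)
      (stacks x u (Digit d # v) [] (word_tape w) ?k)"
    using exec_pop[of Todo "stacks x (Digit d # u) (Digit d # v) [] (word_tape w) ?k"] by simp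
  have start: "state (initial_config (M d) w) = tm_start (M d)" by (simp add: initial_config_def)
  obtain l r k' where sim: "exec (simulate M) (stacks x u (Digit d # v) [] (word_tape w) ?k)
      (stacks x u (Digit d # v) l r k')" and split: "tape_split (run (M d) w t) l r"
    using exec_simulate[where M = M and d = d and x = x and u = u and v = "Digit d # v" and k = k,
        OF tape_split_initial assms(1)[unfolded run_def]]
    unfolding start run_def by blast
  have rewind: "exec (pour Lft Rgt) (stacks x u (Digit d # v) l r k') (stacks x u (Digit d # v) [] (rev l @ r) k')"
    using exec_pour[of Lft Rgt "stacks x u (Digit d # v) l r k'"] by simp
  let ?rest = "dropWhile (\<lambda>a. a \<noteq> Sy Blank) (rev l @ r)"
  have read: "exec (pour_while (\<lambda>a. a \<noteq> Sy Blank) Rgt Lft) (stacks x u (Digit d # v) [] (rev l @ r) k')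
      (stacks x u (Digit d # v) (rev (word_tape w')) ?rest k')"
    using exec_pour_while[of Rgt Lft "\<lambda>a. a \<noteq> Sy Blank" "stacks x u (Digit d # v) [] (rev l @ r) k'"]
    by (simp del: takeWhile_append dropWhile_append add: tape_split_output[OF split assms(2)])
  have wipe: "exec (clear Rgt) (stacks x u (Digit d # v) (rev (word_tape w')) ?rest k')
      (stacks x u (Digit d # v) (rev (word_tape w')) [] k')"
    using exec_clear[of Rgt "stacks x u (Digit d # v) (rev (word_tape w')) ?rest k'"] by simp
  have return: "exec (pour Lft Rgt) (stacks x u (Digit d # v) (rev (word_tape w')) [] k')
      (stacks x u (Digit d # v) [] (word_tape w') k')"
    using exec_pour[of Lft Rgt "stacks x u (Digit d # v) (rev (word_tape w')) [] k'"] by simp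
  show ?thesis
    unfolding apply_generator_def
    using exec_Seq[OF load exec_Seq[OF keep exec_Seq[OF drop exec_Seq[OF sim
      exec_Seq[OF rewind exec_Seq[OF read exec_Seq[OF wipe return]]]]]]]
    by (rule exI)
qed

section \<open>Enumerating words by an odometer\<close>

text \<open>
  The successor in bijective base \<open>n\<close>, where the digit \<open>d\<close> has the value \<open>d + 1\<close> and the head of
  the list is the least significant digit. Unlike ordinary base \<open>n\<close>, every list of digits is the
  numeral of exactly one number, so iterating \<open>incr n\<close> from the empty list visits every word.
\<close>

fun incr :: "nat \<Rightarrow> nat list \<Rightarrow> nat list" where
  "incr n [] = [0]"
| "incr n (d # v) = (if Suc d < n then Suc d # v else 0 # incr n v)"

lemma incr_digits: "0 < n \<Longrightarrow> set v \<subseteq> {..<n} \<Longrightarrow> set (incr n v) \<subseteq> {..<n}"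
  by (induction v) auto

fun odometer_value :: "nat \<Rightarrow> nat list \<Rightarrow> nat" where
  "odometer_value n [] = 0"
| "odometer_value n (d # v) = Suc d + n * odometer_value n v"

lemma odometer_value_incr:
  "0 < n \<Longrightarrow> set v \<subseteq> {..<n} \<Longrightarrow> odometer_value n (incr n v) = Suc (odometer_value n v)"
proof (induction v)
  case (Cons d v)
  then have "n = Suc d" if "\<not> Suc d < n" using that by simp
  with Cons show ?case by (auto simp: algebra_simps)
qed simp

lemma incr_surj:
  "0 < n \<Longrightarrow> set v \<subseteq> {..<n} \<Longrightarrow> v \<noteq> [] \<Longrightarrow> \<exists>u. set u \<subseteq> {..<n} \<and> incr n u = v"
proof (induction v)
  case (Cons d v)
  show ?case
  proof (cases d)
    case (Suc e)
    then show ?thesis using Cons.prems by (intro exI[of _ "e # v"]) auto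
  next
    case 0
    show ?thesis
    proof (cases "v = []")
      case True
      then show ?thesis using 0 by (intro exI[of _ "[]"]) simp
    next
      case False
      then obtain u where "set u \<subseteq> {..<n}" "incr n u = v" using Cons by auto
      then show ?thesis using 0 Cons.prems(1) by (intro exI[of _ "(n - 1) # u"]) auto
    qed
  qed
qed simp

lemma incr_enumerates:
  assumes "0 < n" "set v \<subseteq> {..<n}"
  shows "\<exists>m. (incr n ^^ m) [] = v"
  using assms(2)
proof (induction "odometer_value n v" arbitrary: v rule: less_induct)
  case less
  show ?case
  proof (cases "v = []")
    case True
    then show ?thesis by (intro exI[of _ 0]) simp
  next
    case False
    then obtain u where u: "set u \<subseteq> {..<n}" "incr n u = v" using incr_surj[OF assms(1) less.prems] by blast
    then have "odometer_value n u < odometer_value n v" using odometer_value_incr[OF assms(1) u(1)] by simp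
    then obtain m where "(incr n ^^ m) [] = u" using less.hyps u(1) by blast
    then show ?thesis using u(2) by (intro exI[of _ "Suc m"]) simp
  qed
qed

text \<open>
  When the odometer is advanced, all generators are on \<open>Done\<close>, with the least significant digit
  on top. Moving them back to \<open>Todo\<close> is combined with the increment.
\<close>

definition carry :: "nat \<Rightarrow> (track, 'a stk) com" where
  "carry n = While (\<lambda>t. t Done = Some (Digit (n - 1))) (push Todo (Digit 0) ;; pop Done)"

text \<open>
  After \<open>carry\<close> the top digit is less than \<open>n - 1\<close> and is simply increased by one. The reduction
  modulo \<open>n\<close> keeps the pushed symbol inside a finite alphabet for every conceivable top.
\<close>

definition increment :: "nat \<Rightarrow> (track, 'a stk) com" where
  "increment n =
     carry n ;;
     Do (\<lambda>t. Push Todo (Digit (case t Done of Some (Digit d) \<Rightarrow> Suc d mod n | _ \<Rightarrow> 0))) ;;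
     pop Done ;;
     pour Done Todo"

text \<open>
  \<open>v'\<close> is what remains of \<open>v\<close> after its \<open>m\<close> leading maximal digits have been turned into zeros.
\<close>

lemma exec_carry:
  assumes "0 < n" "set v \<subseteq> {..<n}"
  shows "\<exists>v' m. set v' \<subseteq> {..<n} \<and> (v' = [] \<or> Suc (hd v') < n) \<and> incr n v = replicate m 0 @ incr n v' \<and>
           exec (carry n) (stacks x z (map Digit v) l r k) (stacks x (replicate m (Digit 0) @ z) (map Digit v') l r k)"
  using assms(2)
proof (induction v arbitrary: z)
  case Nil
  let ?s = "stacks x z (map Digit []) l r k"
  have "exec (carry n) ?s ?s" unfolding carry_def by (rule exec_While_False) simp
  then show ?case by (intro exI[of _ "[]"] exI[of _ 0]) simp
next
  case (Cons d v)
  let ?s = "stacks x z (map Digit (d # v)) l r k"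
  show ?case
  proof (cases "Suc d < n")
    case True
    have "exec (carry n) ?s ?s" unfolding carry_def by (rule exec_While_False) (use True in simp)
    then show ?thesis using True Cons.prems by (intro exI[of _ "d # v"] exI[of _ 0]) simp
  next
    case False
    then have d: "d = n - 1" using Cons.prems by auto
    obtain v' m where v': "set v' \<subseteq> {..<n}" "v' = [] \<or> Suc (hd v') < n" "incr n v = replicate m 0 @ incr n v'"
      and rest: "exec (carry n) (stacks x (Digit 0 # z) (map Digit v) l r k)
        (stacks x (replicate m (Digit 0) @ Digit 0 # z) (map Digit v') l r k)"
      using Cons.IH[of "Digit 0 # z"] Cons.prems by auto
    have one: "exec (push Todo (Digit 0) ;; pop Done) ?s (stacks x (Digit 0 # z) (map Digit v) l r k)"
      using exec_Seq[OF exec_push[of Todo "Digit 0" ?s] exec_pop[of Done]] by simp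
    have "exec (carry n) ?s (stacks x (replicate m (Digit 0) @ Digit 0 # z) (map Digit v') l r k)"
      unfolding carry_def by (rule exec_While_True[OF _ one rest[unfolded carry_def]]) (simp add: d)
    moreover have "replicate m (Digit 0) @ Digit 0 # z = replicate (Suc m) (Digit 0) @ z"
      by (simp add: replicate_app_Cons_same)
    moreover have "incr n (d # v) = replicate (Suc m) 0 @ incr n v'" using False v'(3) by simp
    ultimately show ?thesis using v'(1,2) by (intro exI[of _ v'] exI[of _ "Suc m"]) simp
  qed
qed

lemma exec_increment:
  assumes "0 < n" "set v \<subseteq> {..<n}"
  shows "exec (increment n) (stacks x [] (map Digit v) l r k) (stacks x (rev (map Digit (incr n v))) [] l r k)"
proof -
  obtain v' m where v': "v' = [] \<or> Suc (hd v') < n" "incr n v = replicate m 0 @ incr n v'"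
    and loop: "exec (carry n) (stacks x [] (map Digit v) l r k)
      (stacks x (replicate m (Digit 0) @ []) (map Digit v') l r k)"
    using exec_carry[OF assms, of x "[]" l r k] by blast
  let ?z = "replicate m (Digit 0)"
  let ?e = "case v' of [] \<Rightarrow> 0 | d # _ \<Rightarrow> Suc d"
  have bump: "exec (Do (\<lambda>t. Push Todo (Digit (case t Done of Some (Digit d) \<Rightarrow> Suc d mod n | _ \<Rightarrow> 0))))
      (stacks x (?z @ []) (map Digit v') l r k) (stacks x (Digit ?e # ?z) (map Digit v') l r k)"
    by (rule exec_Do) (use v'(1) in \<open>cases v'; simp\<close>)
  have drop: "exec (pop Done) (stacks x (Digit ?e # ?z) (map Digit v') l r k)
      (stacks x (Digit ?e # ?z) (map Digit (tl v')) l r k)"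
    using exec_pop[of Done "stacks x (Digit ?e # ?z) (map Digit v') l r k"] by (simp add: map_tl)
  have "incr n v' = ?e # tl v'" using v'(1) by (cases v') auto
  then have final: "rev (map Digit (tl v')) @ Digit ?e # ?z = rev (map Digit (incr n v))"
    by (simp add: v'(2))
  have restore: "exec (pour Done Todo) (stacks x (Digit ?e # ?z) (map Digit (tl v')) l r k)
      (stacks x (rev (map Digit (incr n v))) [] l r k)"
    using exec_pour[of Done Todo "stacks x (Digit ?e # ?z) (map Digit (tl v')) l r k"]
    by (simp add: final[simplified])
  show ?thesis
    unfolding increment_def by (rule exec_Seq[OF loop exec_Seq[OF bump exec_Seq[OF drop restore]]])
qed


section \<open>Searching the orbit of a word\<close>

text \<open>
  The common prefix of the input and the computed word is moved from \<open>Inp\<close> to \<open>Lft\<close>, so that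
  the input can be restored afterwards.
\<close>

definition match :: "(track, 'a stk) com" where
  "match = While (\<lambda>t. t Inp \<noteq> None \<and> t Inp = t Rgt) (copy Inp Lft ;; pop Inp ;; pop Rgt)"

definition compare :: "(track, 'a stk) com" where
  "compare =
     pop Rgt ;; match ;;
     Do (\<lambda>t. Push Ctl (if t Inp = None \<and> t Rgt = None then Accept else Reject)) ;;
     pour Lft Inp ;; clear Rgt"

lemma exec_match:
  "\<exists>p x' r'. x = p @ x' \<and> (x' = [] \<and> r' = [] \<longleftrightarrow> x = r) \<and>
     exec match (stacks x u v l r k) (stacks x' u v (rev p @ l) r' k)"
proof (induction x arbitrary: l r)
  case Nil
  have "exec match (stacks [] u v l r k) (stacks [] u v (rev [] @ l) r k)"
    unfolding match_def by (simp add: exec_While_False)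
  moreover have "[] = [] @ []" "[] = [] \<and> r = [] \<longleftrightarrow> [] = r" by auto
  ultimately show ?case by (intro exI conjI)
next
  case (Cons a x)
  let ?s = "stacks (a # x) u v l r k"
  show ?case
  proof (cases "\<exists>r1. r = a # r1")
    case True
    then obtain r1 where r: "r = a # r1" by blast
    obtain p x' r' where IH: "x = p @ x'" "x' = [] \<and> r' = [] \<longleftrightarrow> x = r1"
      and rest: "exec match (stacks x u v (a # l) r1 k) (stacks x' u v (rev p @ a # l) r' k)"
      using Cons.IH[of r1 "a # l"] by auto
    have cp: "exec (copy Inp Lft) ?s (stacks (a # x) u v (a # l) r k)"
      using exec_copy[of ?s Inp a x Lft] by simp
    have one: "exec (copy Inp Lft ;; pop Inp ;; pop Rgt) ?s (stacks x u v (a # l) r1 k)"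
      using exec_Seq[OF cp exec_Seq[OF exec_pop[of Inp] exec_pop[of Rgt]]] by (simp add: r)
    have "exec match ?s (stacks x' u v (rev p @ a # l) r' k)"
      unfolding match_def by (rule exec_While_True[OF _ one rest[unfolded match_def]]) (simp add: r)
    then have "exec match ?s (stacks x' u v (rev (a # p) @ l) r' k)" by simp
    moreover have "a # x = (a # p) @ x'" "x' = [] \<and> r' = [] \<longleftrightarrow> a # x = r"
      using IH r by simp_all
    ultimately show ?thesis by (intro exI conjI)
  next
    case False
    then have "\<not> (tops ?s Inp \<noteq> None \<and> tops ?s Inp = tops ?s Rgt)" by (cases r) auto
    then have "exec match ?s (stacks (a # x) u v (rev [] @ l) r k)"
      unfolding match_def by (simp add: exec_While_False)
    moreover have "a # x = [] @ a # x" "a # x = [] \<and> r = [] \<longleftrightarrow> a # x = r" using False by auto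
    ultimately show ?thesis by (intro exI conjI)
  qed
qed

lemma exec_compare:
  "exec compare (stacks x u v [] (Sy LeftEnd # r) k)
     (stacks x u v [] [] ((if x = r then Accept else Reject) # k))"
proof -
  obtain p x' r' where split: "x = p @ x'" "x' = [] \<and> r' = [] \<longleftrightarrow> x = r"
    and loop: "exec match (stacks x u v [] r k) (stacks x' u v (rev p @ []) r' k)"
    using exec_match[of x r u v "[]" k] by blast
  let ?k = "(if x = r then Accept else Reject) # k"
  have drop: "exec (pop Rgt) (stacks x u v [] (Sy LeftEnd # r) k) (stacks x u v [] r k)"
    using exec_pop[of Rgt "stacks x u v [] (Sy LeftEnd # r) k"] by simp
  have verdict: "exec (Do (\<lambda>t. Push Ctl (if t Inp = None \<and> t Rgt = None then Accept else Reject)))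
      (stacks x' u v (rev p @ []) r' k) (stacks x' u v (rev p) r' ?k)"
    by (rule exec_Do) (use split(2) in \<open>cases x'; cases r'; simp\<close>)
  have restore: "exec (pour Lft Inp) (stacks x' u v (rev p) r' ?k) (stacks x u v [] r' ?k)"
    using exec_pour[of Lft Inp "stacks x' u v (rev p) r' ?k"] split(1) by simp
  have wipe: "exec (clear Rgt) (stacks x u v [] r' ?k) (stacks x u v [] [] ?k)"
    using exec_clear[of Rgt "stacks x u v [] r' ?k"] by simp
  show ?thesis
    unfolding compare_def
    by (rule exec_Seq[OF drop exec_Seq[OF loop exec_Seq[OF verdict exec_Seq[OF restore wipe]]]])
qed

definition evaluate :: "(nat \<Rightarrow> 'a tm) \<Rightarrow> 'a list \<Rightarrow> (track, 'a stk) com" where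
  "evaluate M w0 = push_all Rgt (word_tape w0) ;; While (\<lambda>t. t Todo \<noteq> None) (apply_generator M)"

definition search :: "nat \<Rightarrow> (nat \<Rightarrow> 'a tm) \<Rightarrow> 'a list \<Rightarrow> (track, 'a stk) com" where
  "search n M w0 = While (\<lambda>t. t Ctl \<noteq> Some Accept) (evaluate M w0 ;; compare ;; increment n)"

text \<open>
  Closed under everything that the search pushes, for arbitrary tops over this alphabet and not only
  for those that occur in a run: \<open>com_within\<close> demands no less.
\<close>

definition alphabet :: "'a set \<Rightarrow> nat \<Rightarrow> (nat \<Rightarrow> 'a tm) \<Rightarrow> 'a stk set" where
  "alphabet \<Sigma> n M =
     (let A = {LeftEnd, Blank} \<union> Letter ` \<Sigma> \<union> (\<Union>d<n. tm_symbols (M d)) in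
      {Accept, Reject} \<union> Digit ` {..<n} \<union> Sy ` A \<union> (\<Union>d<n. St d ` tm_states (M d)) \<union>
      (\<Union>d<n. \<Union>q\<in>tm_states (M d). \<Union>b\<in>A. Act d q b ` {MoveLeft, Stay, MoveRight}))"

locale generator_machines =
  fixes \<Sigma> :: "'a set" and n :: nat and M :: "nat \<Rightarrow> 'a tm" and F :: "nat \<Rightarrow> 'a list \<Rightarrow> 'a list"
    and w0 :: "'a list"
  assumes finite_letters: "finite \<Sigma>"
    and n_pos: "0 < n"
    and machine: "d < n \<Longrightarrow> pf_tm \<Sigma> (M d)"
    and closed: "d < n \<Longrightarrow> w \<in> lists \<Sigma> \<Longrightarrow> F d w \<in> lists \<Sigma>"
    and computes: "d < n \<Longrightarrow> w \<in> lists \<Sigma> \<Longrightarrow>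
      \<exists>t. halts_accepting (M d) (run (M d) w t) \<and> has_output (run (M d) w t) (F d w)"
    and base: "w0 \<in> lists \<Sigma>"
begin

lemma exec_apply_all:
  assumes "set u \<subseteq> {..<n}" "w \<in> lists \<Sigma>"
  shows "\<exists>k'. exec (While (\<lambda>t. t Todo \<noteq> None) (apply_generator M))
           (stacks x (map Digit u) v [] (word_tape w) k)
           (stacks x [] (rev (map Digit u) @ v) [] (word_tape (fold F u w)) k')"
  using assms
proof (induction u arbitrary: v w k)
  case Nil
  have "exec (While (\<lambda>t. t Todo \<noteq> None) (apply_generator M))
      (stacks x [] v [] (word_tape w) k) (stacks x [] v [] (word_tape w) k)"
    by (rule exec_While_False) simp
  then show ?case by (intro exI[of _ k]) simp
next
  case (Cons d u)
  let ?s = "stacks x (map Digit (d # u)) v [] (word_tape w) k"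
  have d: "d < n" using Cons.prems(1) by simp
  obtain t where "halts_accepting (M d) (run (M d) w t)" "has_output (run (M d) w t) (F d w)"
    using computes[OF d Cons.prems(2)] by blast
  then obtain k1 where one: "exec (apply_generator M) ?s (stacks x (map Digit u) (Digit d # v) [] (word_tape (F d w)) k1)"
    using exec_apply_generator[of M d w t "F d w" x "map Digit u" v k] by auto
  obtain k' where rest: "exec (While (\<lambda>t. t Todo \<noteq> None) (apply_generator M))
      (stacks x (map Digit u) (Digit d # v) [] (word_tape (F d w)) k1)
      (stacks x [] (rev (map Digit u) @ Digit d # v) [] (word_tape (fold F u (F d w))) k')"
    using Cons.IH[of "F d w" "Digit d # v" k1] Cons.prems closed[OF d] by auto
  have "exec (While (\<lambda>t. t Todo \<noteq> None) (apply_generator M)) ?s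
      (stacks x [] (rev (map Digit u) @ Digit d # v) [] (word_tape (fold F u (F d w))) k')"
    by (rule exec_While_True[OF _ one rest]) simp
  then show ?case by (intro exI[of _ k']) simp
qed

lemma exec_search_body:
  assumes "set v \<subseteq> {..<n}"
  shows "\<exists>k'. exec (evaluate M w0 ;; compare ;; increment n)
           (stacks (map (\<lambda>a. Sy (Letter a)) x) (rev (map Digit v)) [] [] [] k)
           (stacks (map (\<lambda>a. Sy (Letter a)) x) (rev (map Digit (incr n v))) [] [] []
              ((if fold F (rev v) w0 = x then Accept else Reject) # k'))"
proof -
  let ?x = "map (\<lambda>a. Sy (Letter a)) x" and ?w = "fold F (rev v) w0"
  have load: "exec (push_all Rgt (word_tape w0)) (stacks ?x (rev (map Digit v)) [] [] [] k)
      (stacks ?x (rev (map Digit v)) [] [] (word_tape w0) k)"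
    using exec_push_all[of Rgt "word_tape w0" "stacks ?x (rev (map Digit v)) [] [] [] k"] by simp
  obtain k' where run: "exec (While (\<lambda>t. t Todo \<noteq> None) (apply_generator M))
      (stacks ?x (rev (map Digit v)) [] [] (word_tape w0) k)
      (stacks ?x [] (map Digit v) [] (word_tape ?w) k')"
    using exec_apply_all[of "rev v" w0 ?x "[]" k] assms base by (auto simp: rev_map)
  have eq: "?x = map (\<lambda>a. Sy (Letter a)) ?w \<longleftrightarrow> ?w = x"
    using inj_map_eq_map[of "\<lambda>a. Sy (Letter a)" x ?w] by (auto simp: inj_def)
  have check: "exec compare (stacks ?x [] (map Digit v) [] (word_tape ?w) k')
      (stacks ?x [] (map Digit v) [] [] ((if ?w = x then Accept else Reject) # k'))"
    using exec_compare[of ?x "[]" "map Digit v" "map (\<lambda>a. Sy (Letter a)) ?w" k']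
    by (simp only: eq word_tape_def)
  show ?thesis
    unfolding evaluate_def
    using exec_Seq[OF exec_Seq[OF load run] exec_Seq[OF check exec_increment[OF n_pos assms]]]
    by (rule exI)
qed

text \<open>
  As an abstract system the search is an odometer with a flag that records whether the word just
  evaluated was the input. The odometer holds \<open>v\<close> while the program applies the generators in the
  order \<open>rev v\<close>; reversal permutes the words, so all of them are still tried.
\<close>

lemma search_halts:
  "halts (sstep com_step) (shalted com_step)
     (search n M w0, (\<lambda>_. [])(Inp := map (\<lambda>a. Sy (Letter a)) x)) \<longleftrightarrow>
   (\<exists>v. set v \<subseteq> {..<n} \<and> fold F v w0 = x)"
proof -
  let ?x = "map (\<lambda>a. Sy (Letter a)) x"
  define f where "f = (\<lambda>(v, found :: bool). (incr n v, fold F (rev v) w0 = x))"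
  define R where "R a s \<longleftrightarrow> set (fst a) \<subseteq> {..<n} \<and>
    (\<exists>k. s = stacks ?x (rev (map Digit (fst a))) [] [] [] k \<and> (snd a \<longleftrightarrow> tops s Ctl = Some Accept))"
    for a :: "nat list \<times> bool" and s
  have initial: "(\<lambda>_. [])(Inp := ?x) = stacks ?x [] [] [] [] []"
    by (rule ext, rename_tac i, case_tac i, simp_all)
  have program: "halts f snd ([], False) \<longleftrightarrow>
      halts (sstep com_step) (shalted com_step) (search n M w0, (\<lambda>_. [])(Inp := ?x))"
    unfolding search_def
  proof (rule halts_While[where R = R])
    show "R ([], False) ((\<lambda>_. [])(Inp := ?x))" unfolding R_def initial
      by (intro conjI exI[of _ "[]"]) simp_all
    show "snd a \<longleftrightarrow> \<not> tops s Ctl \<noteq> Some Accept" if "R a s" for a s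
      using that unfolding R_def by blast
    show "\<exists>s'. exec (evaluate M w0 ;; compare ;; increment n) s s' \<and> R (f a) s'" if R: "R a s" for a s
    proof -
      obtain v found where a: "a = (v, found)" by (cases a)
      obtain k where v: "set v \<subseteq> {..<n}" and s: "s = stacks ?x (rev (map Digit v)) [] [] [] k"
        using R unfolding R_def a by auto
      obtain k' where body: "exec (evaluate M w0 ;; compare ;; increment n) s
          (stacks ?x (rev (map Digit (incr n v))) [] [] [] ((if fold F (rev v) w0 = x then Accept else Reject) # k'))"
        using exec_search_body[OF v, of x k] unfolding s by blast
      show ?thesis
      proof (intro exI conjI)
        show "exec (evaluate M w0 ;; compare ;; increment n) s
          (stacks ?x (rev (map Digit (incr n v))) [] [] [] ((if fold F (rev v) w0 = x then Accept else Reject) # k'))"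
          by (rule body)
        show "R (f a) (stacks ?x (rev (map Digit (incr n v))) [] [] [] ((if fold F (rev v) w0 = x then Accept else Reject) # k'))"
          unfolding R_def a f_def
          by (intro conjI exI[of _ "(if fold F (rev v) w0 = x then Accept else Reject) # k'"])
            (simp_all add: incr_digits[OF n_pos v])
      qed
    qed
  qed
  have iterate: "(f ^^ Suc m) ([], False) = ((incr n ^^ Suc m) [], fold F (rev ((incr n ^^ m) [])) w0 = x)" for m
    by (induction m) (simp_all add: f_def)
  have reached: "halts f snd ([], False) \<longleftrightarrow> (\<exists>m. fold F (rev ((incr n ^^ m) [])) w0 = x)"
  proof
    assume "halts f snd ([], False)"
    then obtain m where m: "snd ((f ^^ m) ([], False))" by (auto simp: halts_def)
    then obtain m' where "m = Suc m'" by (cases m) auto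
    then show "\<exists>m. fold F (rev ((incr n ^^ m) [])) w0 = x" using m iterate[of m'] by (intro exI[of _ m']) simp
  next
    assume "\<exists>m. fold F (rev ((incr n ^^ m) [])) w0 = x"
    then obtain m where "fold F (rev ((incr n ^^ m) [])) w0 = x" by blast
    then have "snd ((f ^^ Suc m) ([], False))" by (simp only: iterate snd_conv)
    then show "halts f snd ([], False)" unfolding halts_def by (rule exI)
  qed
  have words: "(\<exists>m. fold F (rev ((incr n ^^ m) [])) w0 = x) \<longleftrightarrow> (\<exists>v. set v \<subseteq> {..<n} \<and> fold F v w0 = x)"
  proof
    have "set ((incr n ^^ m) []) \<subseteq> {..<n}" for m
      by (induction m) (simp_all add: incr_digits[OF n_pos])
    then show "\<exists>m. fold F (rev ((incr n ^^ m) [])) w0 = x \<Longrightarrow> \<exists>v. set v \<subseteq> {..<n} \<and> fold F v w0 = x"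
      by (metis set_rev)
    show "\<exists>v. set v \<subseteq> {..<n} \<and> fold F v w0 = x \<Longrightarrow> \<exists>m. fold F (rev ((incr n ^^ m) [])) w0 = x"
      using incr_enumerates[OF n_pos] by (metis set_rev rev_rev_ident)
  qed
  show ?thesis unfolding program[symmetric] reached by (rule words)
qed

lemma finite_alphabet: "finite (alphabet \<Sigma> n M)"
  using finite_letters machine unfolding alphabet_def Let_def by (auto simp: pf_tm_def)

lemma alphabet_simps:
  "Accept \<in> alphabet \<Sigma> n M" "Reject \<in> alphabet \<Sigma> n M"
  "Digit d \<in> alphabet \<Sigma> n M \<longleftrightarrow> d < n"
  "Sy b \<in> alphabet \<Sigma> n M \<longleftrightarrow> b \<in> {LeftEnd, Blank} \<union> Letter ` \<Sigma> \<union> (\<Union>d<n. tm_symbols (M d))"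
  "St d q \<in> alphabet \<Sigma> n M \<longleftrightarrow> d < n \<and> q \<in> tm_states (M d)"
  "Act d q b m \<in> alphabet \<Sigma> n M \<longleftrightarrow> d < n \<and> q \<in> tm_states (M d) \<and> Sy b \<in> alphabet \<Sigma> n M"
  using move.exhaust[of m] by (auto simp: alphabet_def Let_def)

lemma action_within:
  assumes t: "t \<in> cells (alphabet \<Sigma> n M)" and a: "action M t = Some a"
  shows "a \<in> alphabet \<Sigma> n M"
proof -
  obtain d q where ctl: "t Ctl = Some (St d q)"
    using a by (auto simp: action_def split: option.splits stk.splits)
  define c where "c = (case t Rgt of Some (Sy a) \<Rightarrow> a | _ \<Rightarrow> Blank)"
  obtain q' b m where delta: "tm_delta (M d) q c = Some (q', b, m)" and a': "a = Act d q' b m"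
    using a ctl by (auto simp: action_def c_def)
  have d: "d < n" using cells_entry[OF t ctl] by (simp add: alphabet_simps)
  have "q' \<in> tm_states (M d)" "b \<in> tm_symbols (M d)"
    using machine[OF d] delta unfolding pf_tm_def by blast+
  then show ?thesis using d by (auto simp: a' alphabet_simps)
qed

text \<open>
  Only actions in the alphabet have to be considered, as the action is read from \<open>Ctl\<close>.
\<close>

lemma obey_within:
  assumes "\<And>t d q b m. t \<in> cells (alphabet \<Sigma> n M) \<Longrightarrow> Act d q b m \<in> alphabet \<Sigma> n M \<Longrightarrow>
    op_within (alphabet \<Sigma> n M) (h t d q b m)"
  shows "com_within (alphabet \<Sigma> n M) (obey h)"
  using assms cells_entry[of _ "alphabet \<Sigma> n M" Ctl]
  by (auto simp: obey_def split: option.split stk.split)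

lemma search_within: "com_within (alphabet \<Sigma> n M) (search n M w0)"
proof -
  let ?\<Gamma> = "alphabet \<Sigma> n M"
  have tm: "com_within ?\<Gamma> (tm_step M)"
    unfolding tm_step_def com_within.simps
  proof (intro conjI ballI com_within_macros obey_within)
    show "op_within ?\<Gamma> (case action M t of None \<Rightarrow> Nop | Some a \<Rightarrow> Push Ctl a)" if "t \<in> cells ?\<Gamma>" for t
      using action_within[OF that] by (auto split: option.split)
  qed (auto simp: alphabet_simps push_entry_within split: move.split)
  have start: "op_within ?\<Gamma> (case t Todo of Some (Digit d) \<Rightarrow> Push Ctl (St d (tm_start (M d))) | _ \<Rightarrow> Nop)"
    if t: "t \<in> cells ?\<Gamma>" for t
  proof -
    have "St d (tm_start (M d)) \<in> ?\<Gamma>" if "t Todo = Some (Digit d)" for d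
      using cells_entry[OF t that] machine[of d] by (simp add: alphabet_simps pf_tm_def)
    then show ?thesis by (simp split: option.split stk.split)
  qed
  have "com_within ?\<Gamma> (apply_generator M)"
    using start tm by (simp add: apply_generator_def simulate_def com_within_macros)
  moreover have "set (word_tape w0) \<subseteq> ?\<Gamma>"
    using base by (auto simp: word_tape_def alphabet_simps)
  moreover have "com_within ?\<Gamma> (increment n)"
    using n_pos by (auto simp: increment_def carry_def com_within_macros com_within_push alphabet_simps
      split: option.split stk.split)
  moreover have "com_within ?\<Gamma> compare"
    by (simp add: compare_def match_def com_within_macros alphabet_simps)
  ultimately show ?thesis
    by (simp add: search_def evaluate_def com_within_push_all)
qed

theorem orbit_recursively_enumerable:
  "recursively_enumerable \<Sigma> {fold F v w0 | v. set v \<subseteq> {..<n}}"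
proof -
  have "\<exists>N. pf_tm \<Sigma> N \<and> (\<forall>x\<in>lists \<Sigma>. (\<exists>t. halts_accepting N (run N x t)) \<longleftrightarrow>
      halts (sstep com_step) (shalted com_step) (search n M w0, (\<lambda>_. [])(Inp := map (\<lambda>a. Sy (Letter a)) x)))"
    by (rule program_recognizable[OF finite_alphabet _ _ search_within])
      (auto simp: alphabet_simps inj_on_def)
  then obtain N where N: "pf_tm \<Sigma> N"
    "\<forall>x\<in>lists \<Sigma>. (\<exists>t. halts_accepting N (run N x t)) \<longleftrightarrow> (\<exists>v. set v \<subseteq> {..<n} \<and> fold F v w0 = x)"
    unfolding search_halts by (elim exE conjE)
  have "fold F v w \<in> lists \<Sigma>" if "set v \<subseteq> {..<n}" "w \<in> lists \<Sigma>" for v w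
    using that by (induction v arbitrary: w) (simp_all add: closed)
  then have "{fold F v w0 | v. set v \<subseteq> {..<n}} \<subseteq> lists \<Sigma>" using base by blast
  then show ?thesis
    unfolding recursively_enumerable_def using N by (intro conjI exI[of _ N]) auto
qed

end


section \<open>Cayley representations\<close>

lemma pf_linear_time_computable_closed:
  "pf_linear_time_computable \<Sigma> g \<Longrightarrow> w \<in> lists \<Sigma> \<Longrightarrow> g w \<in> lists \<Sigma>"
  unfolding pf_linear_time_computable_def by (meson image_subset_iff)

lemma pf_linear_time_computable_machine:
  assumes "pf_linear_time_computable \<Sigma> g"
  obtains N where "pf_tm \<Sigma> N"
    "\<And>w. w \<in> lists \<Sigma> \<Longrightarrow> \<exists>t. halts_accepting N (run N w t) \<and> has_output (run N w t) (g w)"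
proof -
  obtain N C where N: "pf_tm \<Sigma> N" "\<forall>w\<in>lists \<Sigma>. \<exists>t \<le> C * (length w + 1).
      halts_accepting N (run N w t) \<and> has_output (run N w t) (g w)"
    using assms unfolding pf_linear_time_computable_def by (elim conjE exE)
  show thesis
  proof (rule that)
    show "pf_tm \<Sigma> N" by (rule N(1))
    fix w assume "w \<in> lists \<Sigma>"
    from bspec[OF N(2) this] show "\<exists>t. halts_accepting N (run N w t) \<and> has_output (run N w t) (g w)"
      by (elim exE conjE) (intro exI conjI)
  qed
qed

text \<open>
  Applying the functions from left to right multiplies by the generators on the right in the same
  order. The product is formed by \<open>foldr\<close>, hence associativity.
\<close>

lemma representation_fold:
  assumes "group G" and gens: "\<And>d. d < n \<Longrightarrow> gen d \<in> carrier G"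
    and \<psi>: "\<psi> ` L \<subseteq> carrier G"
    and act: "\<And>d w. d < n \<Longrightarrow> w \<in> L \<Longrightarrow> F d w \<in> L \<and> \<psi> (F d w) = \<psi> w \<otimes>\<^bsub>G\<^esub> gen d"
  shows "set v \<subseteq> {..<n} \<Longrightarrow> w \<in> L \<Longrightarrow>
    fold F v w \<in> L \<and> foldr (\<otimes>\<^bsub>G\<^esub>) (map gen v) \<one>\<^bsub>G\<^esub> \<in> carrier G \<and>
    \<psi> (fold F v w) = \<psi> w \<otimes>\<^bsub>G\<^esub> foldr (\<otimes>\<^bsub>G\<^esub>) (map gen v) \<one>\<^bsub>G\<^esub>"
proof (induction v arbitrary: w)
  case Nil
  interpret group G by fact
  show ?case using Nil \<psi> by auto
next
  case (Cons d v)
  interpret group G by fact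
  have d: "d < n" using Cons.prems by simp
  have w: "\<psi> w \<in> carrier G" using Cons.prems \<psi> by blast
  have "set v \<subseteq> {..<n}" using Cons.prems by simp
  from Cons.IH[OF this, of "F d w"] act[OF d Cons.prems(2)] show ?case
    using gens[OF d] w by (simp add: m_assoc)
qed

theorem theorem3:
  fixes G :: "('g, 'm) monoid_scheme" and S :: "'g set"
    and \<Sigma> :: "'a set" and L :: "'a list set" and \<psi> :: "'a list \<Rightarrow> 'g"
  assumes "group G"
    and "finite S" and "semigroup_generators G S"
    and "cayley_pf_linear_time_representation G S \<Sigma> L \<psi>"
  shows "recursively_enumerable \<Sigma> L"
proof -
  interpret group G by fact
  have "finite \<Sigma>" and L: "L \<subseteq> lists \<Sigma>" and bij: "bij_betw \<psi> L (carrier G)"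
    and "\<exists>f. \<forall>s\<in>S. pf_linear_time_computable \<Sigma> (f s) \<and> f s ` L \<subseteq> L \<and>
          (\<forall>w\<in>L. \<psi> (f s w) = \<psi> w \<otimes>\<^bsub>G\<^esub> s)"
    using assms(4) by (simp_all only: cayley_pf_linear_time_representation_def)
  then obtain f where f_all: "\<forall>s\<in>S. pf_linear_time_computable \<Sigma> (f s) \<and> f s ` L \<subseteq> L \<and>
      (\<forall>w\<in>L. \<psi> (f s w) = \<psi> w \<otimes>\<^bsub>G\<^esub> s)"
    by (elim exE)
  have f: "\<And>s. s \<in> S \<Longrightarrow> pf_linear_time_computable \<Sigma> (f s)" "\<And>s. s \<in> S \<Longrightarrow> f s ` L \<subseteq> L"
      "\<And>s w. s \<in> S \<Longrightarrow> w \<in> L \<Longrightarrow> \<psi> (f s w) = \<psi> w \<otimes>\<^bsub>G\<^esub> s"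
    using f_all by simp_all
  have S: "S \<subseteq> carrier G" and generated: "\<And>g. g \<in> carrier G \<Longrightarrow>
      \<exists>ss. ss \<noteq> [] \<and> set ss \<subseteq> S \<and> g = foldr (\<otimes>\<^bsub>G\<^esub>) ss \<one>\<^bsub>G\<^esub>"
    using assms(3) by (simp_all only: semigroup_generators_def)
  define n where "n = card S"
  obtain gen where gen: "bij_betw gen {..<n} S"
    using ex_bij_betw_nat_finite[OF assms(2)] by (auto simp: n_def atLeast0LessThan)
  have gen_S: "gen d \<in> S" if "d < n" for d using gen that by (auto simp: bij_betw_def)
  obtain w0 where w0: "w0 \<in> L" "\<psi> w0 = \<one>\<^bsub>G\<^esub>"
    using bij one_closed unfolding bij_betw_def by (metis imageE)
  (* Even the identity is a nonempty product of generators. *)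
  have "S \<noteq> {}" using generated[OF one_closed] by auto
  then have "0 < n" using assms(2) by (simp add: n_def card_gt_0_iff)
  define F where "F d = f (gen d)" for d
  define computed_by where "computed_by d N \<longleftrightarrow> pf_tm \<Sigma> N \<and>
    (\<forall>w\<in>lists \<Sigma>. \<exists>t. halts_accepting N (run N w t) \<and> has_output (run N w t) (F d w))" for d N
  define M where "M d = (SOME N. computed_by d N)" for d
  have M: "computed_by d (M d)" if d: "d < n" for d
  proof -
    have "\<exists>N. computed_by d N"
    proof (rule pf_linear_time_computable_machine[OF f(1)[OF gen_S[OF d]]])
      fix N assume "pf_tm \<Sigma> N"
        "\<And>w. w \<in> lists \<Sigma> \<Longrightarrow> \<exists>t. halts_accepting N (run N w t) \<and> has_output (run N w t) (f (gen d) w)"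
      then show "\<exists>N. computed_by d N" by (intro exI[of _ N]) (simp add: computed_by_def F_def)
    qed
    then show ?thesis unfolding M_def by (rule someI_ex)
  qed
  interpret generator_machines \<Sigma> n M F w0
  proof
    show "finite \<Sigma>" "0 < n" by fact+
    show "w0 \<in> lists \<Sigma>" using w0(1) L by blast
    fix d assume d: "d < n"
    show "pf_tm \<Sigma> (M d)" using M[OF d] by (simp add: computed_by_def)
    fix w assume w: "w \<in> lists \<Sigma>"
    show "F d w \<in> lists \<Sigma>"
      using pf_linear_time_computable_closed[OF f(1)[OF gen_S[OF d]] w] by (simp only: F_def)
    show "\<exists>t. halts_accepting (M d) (run (M d) w t) \<and> has_output (run (M d) w t) (F d w)"
      using M[OF d] w by (simp add: computed_by_def)
  qed
  have fold: "fold F v w0 \<in> L" "\<psi> (fold F v w0) = foldr (\<otimes>\<^bsub>G\<^esub>) (map gen v) \<one>\<^bsub>G\<^esub>"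
    if "set v \<subseteq> {..<n}" for v
  proof -
    have act: "F d w \<in> L \<and> \<psi> (F d w) = \<psi> w \<otimes>\<^bsub>G\<^esub> gen d" if "d < n" "w \<in> L" for d w
      using f(2,3)[OF gen_S[OF that(1)]] that(2) by (auto simp: F_def)
    have "gen d \<in> carrier G" if "d < n" for d using gen_S[OF that] S by blast
    moreover have "\<psi> ` L \<subseteq> carrier G" using bij by (simp add: bij_betw_def)
    ultimately show "fold F v w0 \<in> L" "\<psi> (fold F v w0) = foldr (\<otimes>\<^bsub>G\<^esub>) (map gen v) \<one>\<^bsub>G\<^esub>"
      using representation_fold[of G n gen \<psi> L F v w0] act assms(1) that w0 by simp_all
  qed
  have "L = {fold F v w0 | v. set v \<subseteq> {..<n}}"
  proof
    show "{fold F v w0 | v. set v \<subseteq> {..<n}} \<subseteq> L" using fold(1) by blast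
    show "L \<subseteq> {fold F v w0 | v. set v \<subseteq> {..<n}}"
    proof
      fix x assume x: "x \<in> L"
      then have "\<psi> x \<in> carrier G" using bij by (auto simp: bij_betw_def)
      then obtain ss where ss: "set ss \<subseteq> S" "\<psi> x = foldr (\<otimes>\<^bsub>G\<^esub>) ss \<one>\<^bsub>G\<^esub>"
        using generated by blast
      have "ss \<in> lists (gen ` {..<n})" using ss(1) gen by (auto simp: bij_betw_def)
      then obtain v where v: "set v \<subseteq> {..<n}" "ss = map gen v"
        unfolding lists_image by auto
      have "\<psi> (fold F v w0) = \<psi> x" using fold(2)[OF v(1)] ss(2) v(2) by simp
      then have "fold F v w0 = x" using bij fold(1)[OF v(1)] x by (auto simp: bij_betw_def inj_on_def)
      then show "x \<in> {fold F v w0 | v. set v \<subseteq> {..<n}}" using v(1) by blast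
    qed
  qed
  then show ?thesis using orbit_recursively_enumerable by simp
qed

end
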